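(* Let $T_n$ be the twin group with $n\ge 3$. Then the following hold: (1) $\operatorname{Aut}(T_3)\cong T_3\rtimes \mathbb{Z}_2$. (2) $\operatorname{Aut}(T_4)\cong T_4\rtimes S_3$. (3) $\operatorname{Aut}(T_n)\cong T_n\rtimes D_8$ for $n\ge 5$, where $D_8$ is the dihedral group of order $8$.
   Context: For an integer $n\ge 2$, the twin group $T_n$ is the group generated by $s_1,\dots,s_{n-1}$ with defining relations $s_i^2=1$ for all $i$, and $s_is_j=s_js_i$ whenever $|i-j|\ge 2$. $S_3$ is the symmetric group on $3$ symbols. The symbol $\rtimes$ denotes a semidirect product with the left factor normal; the factor $T_n$ corresponds to $\operatorname{Inn}(T_n)\cong T_n$ (the center of $T_n$ is trivial for $n\geq 3$). *)

theory Defs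
  imports "HOL-Algebra.Bij" "HOL-Algebra.Elementary_Groups" "HOL-Algebra.Sym_Groups"
begin

section \<open>Groups given by generators and relations\<close>

text \<open>The letter \<open>(x, True)\<close> stands for the generator \<open>x\<close>, the letter \<open>(x, False)\<close> for its
  formal inverse. A relation is a pair \<open>(u, v)\<close> of words, read as \<open>u = v\<close>.\<close>

type_synonym 'a word = "('a \<times> bool) list"

definition words :: "'a set \<Rightarrow> 'a word set"
  where "words S = lists (S \<times> UNIV)"

inductive pres_eq :: "'a set \<Rightarrow> ('a word \<times> 'a word) set \<Rightarrow> 'a word \<Rightarrow> 'a word \<Rightarrow> bool"
  for S :: "'a set" and R :: "('a word \<times> 'a word) set"
where
  refl: "u \<in> words S \<Longrightarrow> pres_eq S R u u"
| sym: "pres_eq S R u v \<Longrightarrow> pres_eq S R v u"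
| trans: "pres_eq S R u v \<Longrightarrow> pres_eq S R v w \<Longrightarrow> pres_eq S R u w"
| append: "pres_eq S R u u' \<Longrightarrow> pres_eq S R v v' \<Longrightarrow> pres_eq S R (u @ v) (u' @ v')"
| cancel: "x \<in> S \<Longrightarrow> pres_eq S R [(x, b), (x, \<not> b)] []"
| relation: "(u, v) \<in> R \<Longrightarrow> u \<in> words S \<Longrightarrow> v \<in> words S \<Longrightarrow> pres_eq S R u v"

definition pres_class :: "'a set \<Rightarrow> ('a word \<times> 'a word) set \<Rightarrow> 'a word \<Rightarrow> 'a word set"
  where "pres_class S R u = {v. pres_eq S R u v}"

definition presented_group :: "'a set \<Rightarrow> ('a word \<times> 'a word) set \<Rightarrow> 'a word set monoid"
  where "presented_group S R =
    \<lparr>carrier = pres_class S R ` words S,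
     monoid.mult = (\<lambda>A B. \<Union>u\<in>A. \<Union>v\<in>B. pres_class S R (u @ v)),
     one = pres_class S R []\<rparr>"

lemma words_simps [simp]:
  "[] \<in> words S"
  "a # u \<in> words S \<longleftrightarrow> fst a \<in> S \<and> u \<in> words S"
  "u @ v \<in> words S \<longleftrightarrow> u \<in> words S \<and> v \<in> words S"
  by (cases a; auto simp: words_def)+

lemma pres_eq_in_words: "pres_eq S R u v \<Longrightarrow> u \<in> words S \<and> v \<in> words S"
  by (induction rule: pres_eq.induct) auto

lemma pres_class_eq_iff:
  "u \<in> words S \<Longrightarrow> pres_class S R u = pres_class S R v \<longleftrightarrow> pres_eq S R u v"
  unfolding pres_class_def by (auto intro: pres_eq.intros dest: pres_eq.refl)

lemma pres_class_mult:
  assumes "u \<in> words S" "v \<in> words S"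
  shows "pres_class S R u \<otimes>\<^bsub>presented_group S R\<^esub> pres_class S R v = pres_class S R (u @ v)"
proof -
  have "pres_class S R (u' @ v') = pres_class S R (u @ v)"
    if "pres_eq S R u u'" "pres_eq S R v v'" for u' v'
    using that assms by (metis pres_class_eq_iff pres_eq.append words_simps(3))
  moreover have "pres_eq S R u u" "pres_eq S R v v"
    using assms by (auto intro: pres_eq.refl)
  ultimately have "(\<Union>u'\<in>{u'. pres_eq S R u u'}. \<Union>v'\<in>{v'. pres_eq S R v v'}.
      pres_class S R (u' @ v')) = pres_class S R (u @ v)"
    by blast
  then show ?thesis
    by (simp add: presented_group_def pres_class_def[of S R u] pres_class_def[of S R v])
qed

lemma pres_eq_left_inverse:
  "u \<in> words S \<Longrightarrow> \<exists>v\<in>words S. pres_eq S R (v @ u) []"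
proof (induction u)
  case Nil
  then show ?case
    by (intro bexI[of _ "[]"]) (auto intro: pres_eq.refl)
next
  case (Cons a u)
  obtain x b where a: "a = (x, b)" and x: "x \<in> S" and u: "u \<in> words S"
    using Cons.prems by (cases a) auto
  obtain v where v: "v \<in> words S" "pres_eq S R (v @ u) []"
    using Cons.IH u by blast
  have c: "pres_eq S R [(x, \<not> b), (x, b)] []"
    using pres_eq.cancel[of x S R "\<not> b"] x by simp
  have "pres_eq S R (v @ ([(x, \<not> b), (x, b)] @ u)) (v @ ([] @ u))"
    by (intro pres_eq.append pres_eq.refl v u c)
  then have "pres_eq S R ((v @ [(x, \<not> b)]) @ a # u) []"
    using v(2) by (auto simp: a intro: pres_eq.trans)
  then show ?case
    using v(1) x by (intro bexI[of _ "v @ [(x, \<not> b)]"]) auto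
qed

lemma group_presented_group: "group (presented_group S R)"
proof (rule groupI)
  let ?G = "presented_group S R"
  have carr: "carrier ?G = pres_class S R ` words S" and one: "\<one>\<^bsub>?G\<^esub> = pres_class S R []"
    by (simp_all add: presented_group_def)
  show "A \<otimes>\<^bsub>?G\<^esub> B \<in> carrier ?G" if "A \<in> carrier ?G" "B \<in> carrier ?G" for A B
    using that by (auto simp: carr pres_class_mult)
  show "\<one>\<^bsub>?G\<^esub> \<in> carrier ?G"
    by (auto simp: carr one)
  show "A \<otimes>\<^bsub>?G\<^esub> B \<otimes>\<^bsub>?G\<^esub> C = A \<otimes>\<^bsub>?G\<^esub> (B \<otimes>\<^bsub>?G\<^esub> C)"
    if "A \<in> carrier ?G" "B \<in> carrier ?G" "C \<in> carrier ?G" for A B C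
    using that by (auto simp: carr pres_class_mult)
  show "\<one>\<^bsub>?G\<^esub> \<otimes>\<^bsub>?G\<^esub> A = A" if "A \<in> carrier ?G" for A
    using that by (auto simp: carr one pres_class_mult)
  show "\<exists>B\<in>carrier ?G. B \<otimes>\<^bsub>?G\<^esub> A = \<one>\<^bsub>?G\<^esub>" if A: "A \<in> carrier ?G" for A
  proof -
    obtain u where u: "u \<in> words S" "A = pres_class S R u"
      using A by (auto simp: carr)
    obtain v where v: "v \<in> words S" "pres_eq S R (v @ u) []"
      using pres_eq_left_inverse u(1) by blast
    have "pres_class S R v \<otimes>\<^bsub>?G\<^esub> A = \<one>\<^bsub>?G\<^esub>"
      using u v by (simp add: one pres_class_mult pres_class_eq_iff)
    then show ?thesis
      using v(1) by (auto simp: carr)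
  qed
qed


section \<open>Twin groups\<close>

definition twin_relations :: "nat \<Rightarrow> (nat word \<times> nat word) set"
  where "twin_relations n =
    {([(i, True), (i, True)], []) | i. i \<in> {1..n - 1}} \<union>
    {([(i, True), (j, True)], [(j, True), (i, True)]) | i j.
       i \<in> {1..n - 1} \<and> j \<in> {1..n - 1} \<and> \<bar>int i - int j\<bar> \<ge> 2}"

definition twin_group :: "nat \<Rightarrow> nat word set monoid"
  where "twin_group n = presented_group {1..n - 1} (twin_relations n)"


section \<open>Semidirect products\<close>

text \<open>The external semidirect product of \<open>H\<close> (the normal factor) and \<open>K\<close> for an action \<open>\<phi>\<close>
  of \<open>K\<close> on \<open>H\<close> by automorphisms.\<close>

definition semidirect_product ::
    "('a, 'c) monoid_scheme \<Rightarrow> ('b, 'd) monoid_scheme \<Rightarrow> ('b \<Rightarrow> 'a \<Rightarrow> 'a) \<Rightarrow> ('a \<times> 'b) monoid"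
  where "semidirect_product H K \<phi> =
    \<lparr>carrier = carrier H \<times> carrier K,
     monoid.mult = (\<lambda>(h, k) (h', k'). (h \<otimes>\<^bsub>H\<^esub> \<phi> k h', k \<otimes>\<^bsub>K\<^esub> k')),
     one = (\<one>\<^bsub>H\<^esub>, \<one>\<^bsub>K\<^esub>)\<rparr>"

lemma group_semidirect_product:
  assumes H: "group H" and K: "group K" and \<phi>: "\<phi> \<in> hom K (AutoGroup H)"
  shows "group (semidirect_product H K \<phi>)"
proof -
  interpret H: group H by (fact H)
  interpret K: group K by (fact K)
  interpret A: group "AutoGroup H" by (fact H.AutoGroup)
  have carr: "\<phi> k \<in> auto H" if "k \<in> carrier K" for k
    using hom_in_carrier[OF \<phi> that] by (simp add: AutoGroup_def)
  have mem [simp]: "\<phi> k h \<in> carrier H" if "k \<in> carrier K" "h \<in> carrier H" for k h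
    using carr[OF that(1)] that(2) by (auto simp: auto_def hom_def)
  have mult: "\<phi> k (h \<otimes>\<^bsub>H\<^esub> h') = \<phi> k h \<otimes>\<^bsub>H\<^esub> \<phi> k h'"
    if "k \<in> carrier K" "h \<in> carrier H" "h' \<in> carrier H" for k h h'
    using carr[OF that(1)] that(2,3) by (auto simp: auto_def hom_def)
  have comp: "\<phi> (k \<otimes>\<^bsub>K\<^esub> k') h = \<phi> k (\<phi> k' h)"
    if "k \<in> carrier K" "k' \<in> carrier K" "h \<in> carrier H" for k k' h
    using hom_mult[OF \<phi> that(1,2)] carr[OF that(1)] carr[OF that(2)] that(3)
    by (simp add: AutoGroup_def BijGroup_def auto_def compose_def)
  have one: "\<phi> \<one>\<^bsub>K\<^esub> h = h" if "h \<in> carrier H" for h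
    using hom_one[OF \<phi> K A.group_axioms] that by (simp add: AutoGroup_def BijGroup_def)
  show ?thesis
  proof (rule groupI)
    let ?S = "semidirect_product H K \<phi>"
    show "x \<otimes>\<^bsub>?S\<^esub> y \<in> carrier ?S" if "x \<in> carrier ?S" "y \<in> carrier ?S" for x y
      using that by (auto simp: semidirect_product_def)
    show "\<one>\<^bsub>?S\<^esub> \<in> carrier ?S"
      by (simp add: semidirect_product_def)
    show "x \<otimes>\<^bsub>?S\<^esub> y \<otimes>\<^bsub>?S\<^esub> z = x \<otimes>\<^bsub>?S\<^esub> (y \<otimes>\<^bsub>?S\<^esub> z)"
      if "x \<in> carrier ?S" "y \<in> carrier ?S" "z \<in> carrier ?S" for x y z
      using that by (auto simp: semidirect_product_def H.m_assoc K.m_assoc mult comp)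
    show "\<one>\<^bsub>?S\<^esub> \<otimes>\<^bsub>?S\<^esub> x = x" if "x \<in> carrier ?S" for x
      using that by (auto simp: semidirect_product_def one)
    show "\<exists>y\<in>carrier ?S. y \<otimes>\<^bsub>?S\<^esub> x = \<one>\<^bsub>?S\<^esub>" if x: "x \<in> carrier ?S" for x
    proof -
      obtain h k where hk: "x = (h, k)" "h \<in> carrier H" "k \<in> carrier K"
        using x by (auto simp: semidirect_product_def)
      have "(inv\<^bsub>H\<^esub> (\<phi> (inv\<^bsub>K\<^esub> k) h), inv\<^bsub>K\<^esub> k) \<otimes>\<^bsub>?S\<^esub> x = \<one>\<^bsub>?S\<^esub>"
        using hk by (simp add: semidirect_product_def)
      then show ?thesis
        using hk by (intro bexI[of _ "(inv\<^bsub>H\<^esub> (\<phi> (inv\<^bsub>K\<^esub> k) h), inv\<^bsub>K\<^esub> k)"])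
          (auto simp: semidirect_product_def)
    qed
  qed
qed


section \<open>Dihedral groups\<close>

text \<open>The dihedral group of order \<open>2 * n\<close>, i.e. the group of symmetries of the regular
  \<open>n\<close>-gon, as rotations extended by a reflection that inverts them.\<close>

definition dihedral_group :: "nat \<Rightarrow> (int \<times> int) monoid"
  where "dihedral_group n =
    semidirect_product (integer_mod_group n) (integer_mod_group 2)
      (\<lambda>e. \<lambda>r\<in>carrier (integer_mod_group n). if e = 0 then r else inv\<^bsub>integer_mod_group n\<^esub> r)"

lemma group_dihedral_group: "group (dihedral_group n)"
  unfolding dihedral_group_def
proof (intro group_semidirect_product group_integer_mod_group)
  let ?Z = "integer_mod_group n"
  interpret Z: comm_group ?Z by simp
  have id: "(\<lambda>r\<in>carrier ?Z. r) \<in> auto ?Z"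
    by (rule Z.id_in_auto)
  have "bij_betw (m_inv ?Z) (carrier ?Z) (carrier ?Z)"
    by (rule bij_betwI[where g = "m_inv ?Z"])
       (simp_all del: inv_integer_mod_group add: Pi_iff)
  then have inv: "(\<lambda>r\<in>carrier ?Z. inv\<^bsub>?Z\<^esub> r) \<in> auto ?Z"
    by (simp del: inv_integer_mod_group mult_integer_mod_group
        add: auto_def Bij_def hom_def Pi_iff Z.inv_mult)
  define \<phi> where "\<phi> = (\<lambda>e::int. \<lambda>r\<in>carrier ?Z. if e = 0 then r else inv\<^bsub>?Z\<^esub> r)"
  have auto: "\<phi> e \<in> auto ?Z" for e
    using id inv by (cases "e = 0") (simp_all del: inv_integer_mod_group add: \<phi>_def)
  have "\<phi> \<in> hom (integer_mod_group 2) (AutoGroup ?Z)"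
  proof (rule homI)
    show "\<phi> e \<in> carrier (AutoGroup ?Z)" for e
      using auto by (simp add: AutoGroup_def)
  next
    fix e f :: int
    assume "e \<in> carrier (integer_mod_group 2)" "f \<in> carrier (integer_mod_group 2)"
    then have ef: "e \<in> {0, 1}" "f \<in> {0, 1}"
      by (auto simp: carrier_integer_mod_group)
    have "\<phi> e \<otimes>\<^bsub>AutoGroup ?Z\<^esub> \<phi> f = compose (carrier ?Z) (\<phi> e) (\<phi> f)"
      using auto[of e] auto[of f] by (simp add: AutoGroup_def BijGroup_def auto_def)
    also have "\<dots> = \<phi> (e \<otimes>\<^bsub>integer_mod_group 2\<^esub> f)"
      using ef by (auto simp del: inv_integer_mod_group simp: compose_def \<phi>_def fun_eq_iff)
    finally show "\<phi> (e \<otimes>\<^bsub>integer_mod_group 2\<^esub> f) = \<phi> e \<otimes>\<^bsub>AutoGroup ?Z\<^esub> \<phi> f" ..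
  qed
  then show "(\<lambda>e. \<lambda>r\<in>carrier ?Z. if e = 0 then r else inv\<^bsub>?Z\<^esub> r)
      \<in> hom (integer_mod_group 2) (AutoGroup ?Z)"
    by (simp only: \<phi>_def)
qed

lemma order_dihedral_group: "n > 0 \<Longrightarrow> order (dihedral_group n) = 2 * n"
  by (simp add: order_def dihedral_group_def semidirect_product_def carrier_integer_mod_group)


section \<open>Automorphism groups that split over the inner automorphisms\<close>

definition inner_aut :: "('a, 'c) monoid_scheme \<Rightarrow> 'a \<Rightarrow> 'a \<Rightarrow> 'a"
  where "inner_aut G g = (\<lambda>x\<in>carrier G. g \<otimes>\<^bsub>G\<^esub> x \<otimes>\<^bsub>G\<^esub> inv\<^bsub>G\<^esub> g)"

text \<open>\<open>Aut(G) \<cong> G \<rtimes> K\<close>, where the normal factor \<open>G\<close> is identified with \<open>Inn(G)\<close> by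
  sending \<open>g\<close> to conjugation by \<open>g\<close>. The action of \<open>K\<close> on \<open>G\<close> is unspecified.\<close>

definition Aut_iso_semidirect :: "('a, 'c) monoid_scheme \<Rightarrow> ('b, 'd) monoid_scheme \<Rightarrow> bool"
  where "Aut_iso_semidirect G K \<longleftrightarrow>
    (\<exists>\<phi> \<in> hom K (AutoGroup G). \<exists>\<Psi> \<in> iso (semidirect_product G K \<phi>) (AutoGroup G).
       \<forall>g \<in> carrier G. \<Psi> (g, \<one>\<^bsub>K\<^esub>) = inner_aut G g)"

end

theory Submission
  imports Defs
begin

text \<open>
  \<open>T\<^sub>n\<close> is a right-angled Coxeter group, and its abelianization is \<open>(\<int>/2)\<^sup>n\<^sup>-\<^sup>1\<close>. An automorphism acts on
  it by a matrix over \<open>\<int>/2\<close>. Two adjacent generators have an infinite dihedral quotient, in which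
  an involution cannot be odd in both; hence the supports of consecutive rows of the matrix consist
  of mutually adjacent indices. As the rows are nonzero and distinct, this leaves \<open>2\<close>, \<open>6\<close> or
  \<open>8\<close> matrices for \<open>n = 3\<close>, \<open>n = 4\<close> and \<open>n \<ge> 5\<close>, and these are realized by a group of
  automorphisms generated by the flip \<open>s\<^sub>i \<mapsto> s\<^sub>n\<^sub>-\<^sub>i\<close> and, for \<open>n \<ge> 4\<close>, the twist \<open>s\<^sub>3 \<mapsto> s\<^sub>3 s\<^sub>1\<close>.

  An automorphism with trivial matrix sends each \<open>s\<^sub>i\<close> to a conjugate of \<open>s\<^sub>i\<close>, that is, to a
  reflection. The walls of two commuting reflections cross and those of two noncommuting ones do
  not, so sides of the \<open>n - 1\<close> walls can be chosen that intersect in a single chamber \<open>c\<close>, and the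
  automorphism is conjugation by \<open>c\<close>.
\<close>

text \<open>The counts come from the path 1, ..., n - 1. For n = 3 only the two bijections remain.
  For n = 4 row 2 is forced to be {2}, and rows 1 and 3 are distinct nonempty subsets of {1, 3}: 3 *
  2 choices. For n >= 5 the interior rows are singletons that run along the path in one of two
  directions, and each end row keeps one binary choice: 2 * 2 * 2. For n >= 5 the twist commutes
  with its mirror image under the flip, whereas for n = 4 the two generate S_3. The obstacle is to
  recognize inner automorphisms without normal forms for words. Walls replace them: the parity
  vector of an involution determines which generator it is conjugate to, an automorphism preserves
  commutation, and commutation alone decides how the walls lie. Surjectivity then pins down the
  chamber c. Since the centre is trivial, conjugation embeds the group in its automorphism
  group.\<close>

text \<open>The choice of the word representing \<open>A\<close> is immaterial when \<open>f\<close> respects the relations.\<close>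

definition act :: "(nat \<Rightarrow> 'x \<Rightarrow> 'x) \<Rightarrow> nat word set \<Rightarrow> 'x \<Rightarrow> 'x"
  where "act f A = foldr (\<lambda>l. f (fst l)) (SOME u. u \<in> A)"

abbreviation adj :: "nat \<Rightarrow> nat \<Rightarrow> bool"
  where "adj i j \<equiv> i = Suc j \<or> j = Suc i"

section \<open>Permutations of three letters, and maps out of dihedral groups\<close>

lemma permutes_123_ex:
  assumes "a \<in> {1..3}" "b \<in> {1..3}" "a \<noteq> (b::nat)"
  obtains p where "p permutes {1..3::nat}" "p 1 = a" "p 2 = b"
proof
  \<comment> \<open>\<open>?q\<close> moves 1 to \<open>a\<close>, and \<open>?r\<close> then
    exchanges the image of 2 under \<open>?q\<close> with \<open>b\<close>. That image and
    \<open>b\<close> both differ from \<open>a\<close>, so the value at 1 survives.\<close>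
  let ?q = "transpose 1 a" and ?r = "transpose (transpose 1 a 2) b"
  have "transpose 1 a 2 \<in> {1..3::nat}"
    using assms(1) by (auto simp: transpose_def)
  then show "?r \<circ> ?q permutes {1..3}"
    using assms by (intro permutes_compose permutes_swap_id) auto
  show "(?r \<circ> ?q) 1 = a" "(?r \<circ> ?q) 2 = b"
    using assms(3) by (auto simp: transpose_def)
qed

lemma permutes_123_eq_id:
  assumes p: "p permutes {1..3::nat}" "p 1 = 1" "p 2 = 2"
  shows "p = id"
proof
  fix x
  have "p 3 \<in> {1..3}" "p 3 \<noteq> p 1" "p 3 \<noteq> p 2"
    using permutes_in_image[OF p(1), of 3] permutes_inj[OF p(1)] by (auto simp: inj_eq)
  then have "p 3 = 3"
    using p(2,3) by auto
  moreover have "x = 1 \<or> x = 2 \<or> x = 3 \<or> p x = x"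
    using permutes_not_in[OF p(1), of x] by fastforce
  ultimately show "p x = id x"
    using p(2,3) by auto
qed

text \<open>The rotation by one step goes to \<open>a \<otimes> b\<close> and the reflection to
  \<open>b\<close>. As both are involutions, conjugation by \<open>b\<close> inverts
  \<open>a \<otimes> b\<close>, which together with the two orders is all that the dihedral group
  demands.\<close>

lemma (in group) hom_dihedral_group:
  assumes ab: "a \<in> carrier G" "b \<in> carrier G" "a \<otimes> a = \<one>" "b \<otimes> b = \<one>"
    and m: "m > 0" "(a \<otimes> b) [^] m = \<one>"
  shows "(\<lambda>(r, e). (a \<otimes> b) [^] r \<otimes> (if e = 0 then \<one> else b)) \<in> hom (dihedral_group m) G"
proof -
  define p where "p = a \<otimes> b"
  have p: "p \<in> carrier G" using ab by (simp add: p_def)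
  have inv: "inv a = a" "inv b = b" using ab by (simp_all add: inv_equality)
  have bp: "b \<otimes> p = inv p \<otimes> b"
    using ab inv by (simp add: p_def inv_mult_group m_assoc)
  have bb: "x \<otimes> b \<otimes> b = x" if "x \<in> carrier G" for x
    using that ab by (simp add: m_assoc)
  have nat: "b \<otimes> p [^] k = inv p [^] k \<otimes> b" for k :: nat
  proof (induction k)
    case (Suc k)
    have "b \<otimes> p [^] Suc k = inv p [^] k \<otimes> (b \<otimes> p)"
      using Suc p ab by (simp flip: m_assoc)
    also have "\<dots> = inv p [^] Suc k \<otimes> b"
      using p ab by (simp add: bp m_assoc)
    finally show ?case .
  qed (use ab in simp)
  \<comment> \<open>Rotations are stored as residues below \<open>m\<close>, so a product reduces
    the exponent; the powers of \<open>p\<close> must not notice this.\<close>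
  have mod: "p [^] (x mod int m) = p [^] x" for x :: int
  proof -
    have "p [^] x = p [^] (int m * (x div int m) + x mod int m)"
      by simp
    also have "\<dots> = (p [^] int m) [^] (x div int m) \<otimes> p [^] (x mod int m)"
      using p by (simp only: int_pow_mult int_pow_pow)
    also have "p [^] int m = \<one>"
      using m(2) by (simp add: int_pow_int p_def)
    finally show ?thesis using p by simp
  qed
  define \<rho> where "\<rho> = (\<lambda>(r::int, e::int). p [^] r \<otimes> (if e = 0 then \<one> else b))"
  have "\<rho> \<in> hom (dihedral_group m) G"
  proof (rule homI)
    fix x y assume "x \<in> carrier (dihedral_group m)" "y \<in> carrier (dihedral_group m)"
    then obtain r e q d where xy: "x = (r, e)" "y = (q, d)"
      and rq: "r \<in> carrier (integer_mod_group m)" "q \<in> carrier (integer_mod_group m)"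
      and "e \<in> carrier (integer_mod_group 2)" "d \<in> carrier (integer_mod_group 2)"
      by (auto simp: dihedral_group_def semidirect_product_def)
    then have ed: "e = 0 \<or> e = 1" "d = 0 \<or> d = 1"
      by (auto simp: carrier_integer_mod_group)
    have "q \<ge> 0" using rq m(1) by (simp add: carrier_integer_mod_group)
    then obtain k where k: "q = int k" using nonneg_int_cases by blast
    have "b \<otimes> p [^] q = p [^] (- q) \<otimes> b"
      using nat[of k] p by (simp add: k int_pow_int int_pow_neg nat_pow_inv)
    then have bq: "p [^] r \<otimes> (b \<otimes> p [^] q) = p [^] (r - q) \<otimes> b"
      using p ab by (simp add: int_pow_diff int_pow_neg m_assoc)
    have "x \<otimes>\<^bsub>dihedral_group m\<^esub> y = ((if e = 0 then r + q else r - q) mod int m, (e + d) mod 2)"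
      using rq by (simp add: xy dihedral_group_def semidirect_product_def mod_add_right_eq)
    then show "\<rho> (x \<otimes>\<^bsub>dihedral_group m\<^esub> y) = \<rho> x \<otimes> \<rho> y"
      using ed p ab bq by (auto simp: \<rho>_def xy mod int_pow_mult m_assoc)
        (simp_all add: bb flip: m_assoc)
  qed (use p ab in \<open>auto simp: \<rho>_def\<close>)
  then show ?thesis
    by (simp add: \<rho>_def p_def)
qed

section \<open>The twin group, its generators and its actions\<close>

locale twin = group G for G :: "nat word set monoid" (structure) +
  fixes n :: nat
  assumes G_def: "G = twin_group n"
begin

definition I :: "nat set" where "I = {1..n - 1}"

lemma rel_sq: "i \<in> I \<Longrightarrow> ([(i, True), (i, True)], []) \<in> twin_relations n"
  by (auto simp: twin_relations_def I_def)

lemma rel_comm: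
  assumes "i \<in> I" "j \<in> I" "i \<noteq> j" "\<not> adj i j"
  shows "([(i, True), (j, True)], [(j, True), (i, True)]) \<in> twin_relations n"
proof -
  have "\<bar>int i - int j\<bar> \<ge> 2"
    using assms by auto
  then show ?thesis
    using assms by (auto simp: twin_relations_def I_def)
qed

definition s :: "nat \<Rightarrow> nat word set"
  where "s i = pres_class I (twin_relations n) [(i, True)]"

text \<open>The relations are required on the whole type. An action that makes sense only on the
  carrier is therefore extended by the identity outside, as happens below for walls and for
  endomorphisms.\<close>

definition twin_action :: "(nat \<Rightarrow> 'x \<Rightarrow> 'x) \<Rightarrow> bool"
  where "twin_action f \<longleftrightarrow> (\<forall>i\<in>I. \<forall>x. f i (f i x) = x) \<and>
    (\<forall>i\<in>I. \<forall>j\<in>I. i \<noteq> j \<longrightarrow> \<not> adj i j \<longrightarrow> (\<forall>x. f i (f j x) = f j (f i x)))"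

lemma carrier_G: "carrier G = pres_class I (twin_relations n) ` words I"
  by (simp add: G_def twin_group_def presented_group_def I_def)

lemma one_G: "\<one> = pres_class I (twin_relations n) []"
  by (simp add: G_def twin_group_def presented_group_def I_def)

lemma class_mult:
  "u \<in> words I \<Longrightarrow> v \<in> words I \<Longrightarrow> pres_class I (twin_relations n) u \<otimes>
    pres_class I (twin_relations n) v = pres_class I (twin_relations n) (u @ v)"
  using pres_class_mult[of u I v "twin_relations n"] by (simp add: G_def twin_group_def I_def)

lemma s_closed [simp]: "i \<in> I \<Longrightarrow> s i \<in> carrier G"
  by (auto simp: carrier_G s_def)

lemma s_sq [simp]: "i \<in> I \<Longrightarrow> s i \<otimes> s i = \<one>"
  by (simp add: s_def class_mult one_G pres_class_eq_iff pres_eq.relation rel_sq)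

lemma s_comm: "i \<in> I \<Longrightarrow> j \<in> I \<Longrightarrow> \<not> adj i j \<Longrightarrow> s i \<otimes> s j = s j \<otimes> s i"
  by (cases "i = j")
    (simp_all add: s_def class_mult pres_class_eq_iff pres_eq.relation rel_comm)

lemma s_inv [simp]: "i \<in> I \<Longrightarrow> inv (s i) = s i"
  by (rule inv_equality) auto

text \<open>A generator is its own inverse, so the sign of a letter does not matter. This is why
  \<open>act\<close> looks only at the first component and why words may be replaced by lists of
  indices.\<close>

lemma letter_class:
  assumes "i \<in> I"
  shows "pres_class I (twin_relations n) [(i, b)] = s i"
proof (cases b)
  case False
  have "pres_class I (twin_relations n) [(i, False)] \<otimes> s i = \<one>"
    using assms pres_eq.cancel[of i I "twin_relations n" False]
    by (simp add: s_def class_mult one_G pres_class_eq_iff)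
  moreover have "pres_class I (twin_relations n) [(i, False)] \<in> carrier G"
    using assms by (auto simp: carrier_G)
  ultimately have "inv (s i) = pres_class I (twin_relations n) [(i, False)]"
    using assms by (intro inv_equality) simp_all
  then show ?thesis
    using assms False by simp
qed (simp add: s_def)

lemma left_induct [consumes 1, case_names one mult]:
  assumes "w \<in> carrier G" "P \<one>"
    and "\<And>i w. i \<in> I \<Longrightarrow> w \<in> carrier G \<Longrightarrow> P w \<Longrightarrow> P (s i \<otimes> w)"
  shows "P w"
proof -
  have "P (pres_class I (twin_relations n) u)" if "u \<in> words I" for u
    using that
  proof (induction u)
    case Nil
    then show ?case using assms(2) by (simp add: one_G)
  next
    case (Cons l u)
    obtain i b where l: "l = (i, b)" by force
    have i: "i \<in> I" and "P (s i \<otimes> pres_class I (twin_relations n) u)"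
      using Cons l by (auto simp: carrier_G intro!: assms(3))
    then show ?case
      using Cons.prems by (simp add: l letter_class[of i b, symmetric] class_mult)
  qed
  then show ?thesis
    using assms(1) by (auto simp: carrier_G)
qed

lemma act_class:
  assumes f: "twin_action f" and u: "u \<in> words I"
  shows "act f (pres_class I (twin_relations n) u) = foldr (\<lambda>l. f (fst l)) u"
proof -
  have eq: "foldr (\<lambda>l. f (fst l)) u = foldr (\<lambda>l. f (fst l)) v"
    if "pres_eq I (twin_relations n) u v" for u v
    using that
  proof (induction rule: pres_eq.induct)
    case (append u u' v v')
    then show ?case by simp
  next
    case (cancel x b)
    then show ?case using f by (auto simp: twin_action_def)
  next
    case (relation u v)
    then consider i where "i \<in> I" "u = [(i, True), (i, True)]" "v = []"
      | i j where "i \<in> I" "j \<in> I" "\<bar>int i - int j\<bar> \<ge> 2"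
          "u = [(i, True), (j, True)]" "v = [(j, True), (i, True)]"
      by (auto simp: twin_relations_def I_def)
    then show ?case
    proof cases
      case 1
      then show ?thesis using f by (auto simp: twin_action_def)
    next
      case 2
      then have "i \<noteq> j" "\<not> adj i j" by auto
      then show ?thesis using 2 f by (auto simp: twin_action_def)
    qed
  qed simp_all
  have "(SOME v. v \<in> pres_class I (twin_relations n) u) \<in> pres_class I (twin_relations n) u"
    using pres_eq.refl[OF u] by (intro someI) (auto simp: pres_class_def)
  then show ?thesis
    unfolding act_def by (subst eq[of u]) (auto simp: pres_class_def)
qed

lemma act_one: "twin_action f \<Longrightarrow> act f \<one> x = x"
  by (simp add: one_G act_class del: One_nat_def)

lemma act_s: "twin_action f \<Longrightarrow> i \<in> I \<Longrightarrow> act f (s i) x = f i x"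
  by (simp add: s_def act_class)

lemma act_mult:
  assumes "twin_action f" "u \<in> carrier G" "v \<in> carrier G"
  shows "act f (u \<otimes> v) x = act f u (act f v x)"
  using assms by (auto simp: carrier_G class_mult act_class)

lemma inv_cancel [simp]:
  "x \<in> carrier G \<Longrightarrow> y \<in> carrier G \<Longrightarrow> x \<otimes> (inv x \<otimes> y) = y"
  "x \<in> carrier G \<Longrightarrow> y \<in> carrier G \<Longrightarrow> inv x \<otimes> (x \<otimes> y) = y"
  by (simp_all add: m_assoc[symmetric])

lemma s_cancel [simp]: "i \<in> I \<Longrightarrow> y \<in> carrier G \<Longrightarrow> s i \<otimes> (s i \<otimes> y) = y"
  by (simp add: m_assoc[symmetric])

lemma s_comm_left:
  "i \<in> I \<Longrightarrow> j \<in> I \<Longrightarrow> \<not> adj i j \<Longrightarrow> y \<in> carrier G \<Longrightarrow> s i \<otimes> (s j \<otimes> y) = s j \<otimes> (s i \<otimes> y)"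
  by (simp add: m_assoc[symmetric] s_comm)

lemmas grp = m_assoc inv_mult_group

subsection \<open>Parity of the number of occurrences of a generator\<close>

definition par :: "nat word set \<Rightarrow> nat \<Rightarrow> bool"
  where "par w a = act (\<lambda>i b. if i = a then \<not> b else b) w False"

lemma par_action: "twin_action (\<lambda>i b. if i = a then \<not> b else b)"
  by (auto simp: twin_action_def)

lemma par_one [simp]: "\<not> par \<one> a"
  by (simp add: par_def act_one[OF par_action])

lemma par_s [simp]: "i \<in> I \<Longrightarrow> par (s i) a \<longleftrightarrow> i = a"
  by (simp add: par_def act_s[OF par_action])

lemma par_mult [simp]:
  assumes "u \<in> carrier G" "v \<in> carrier G"
  shows "par (u \<otimes> v) a \<longleftrightarrow> par u a \<noteq> par v a"
proof -
  let ?f = "\<lambda>i b. if i = a then \<not> b else b"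
  have "\<exists>d. \<forall>b. act ?f u b = (b \<noteq> d)"
    using assms(1)
  proof (induction u rule: left_induct)
    case one
    show ?case by (intro exI[of _ False]) (simp add: act_one[OF par_action])
  next
    case (mult i u)
    then obtain d where "\<forall>b. act ?f u b = (b \<noteq> d)" by blast
    with mult.hyps show ?case
      by (intro exI[of _ "d \<noteq> (i = a)"]) (auto simp: act_mult act_s par_action)
  qed
  then obtain d where "\<And>b. act ?f u b = (b \<noteq> d)" by blast
  then show ?thesis
    using assms by (auto simp: par_def act_mult[OF par_action])
qed

lemma par_inv [simp]: "u \<in> carrier G \<Longrightarrow> par (inv u) a \<longleftrightarrow> par u a"
  using par_mult[of u "inv u" a] by simp

lemma par_conj: "u \<in> carrier G \<Longrightarrow> v \<in> carrier G \<Longrightarrow> par (u \<otimes> v \<otimes> inv u) a \<longleftrightarrow> par v a"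
  by auto

subsection \<open>Retractions onto infinite dihedral groups\<close>

text \<open>The action of the infinite dihedral group on the integers: \<open>s i\<close> is the
  reflection in 0, \<open>s j\<close> the reflection in 1/2, and all other generators act trivially.
  For adjacent \<open>i\<close> and \<open>j\<close> the two reflections have no relation to satisfy
  besides being involutions.\<close>

definition psi :: "nat \<Rightarrow> nat \<Rightarrow> nat word set \<Rightarrow> int \<Rightarrow> int"
  where "psi i j = act (\<lambda>k x. if k = i then - x else if k = j then 1 - x else x)"

lemma psi_action: "adj i j \<Longrightarrow> twin_action (\<lambda>k (x::int). if k = i then - x else if k = j then 1 - x else x)"
  by (auto simp: twin_action_def)

lemmas psi_simps =
  act_one[OF psi_action, folded psi_def] act_s[OF psi_action, folded psi_def]
  act_mult[OF psi_action, folded psi_def]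

text \<open>An element with odd exponent sums in two adjacent generators is sent to a translation by an
  odd number, which is not an involution.\<close>

lemma involution_par:
  assumes w: "w \<in> carrier G" "w \<otimes> w = \<one>" and ij: "adj i j"
  shows "\<not> (par w i \<and> par w j)"
proof
  assume p: "par w i \<and> par w j"
  \<comment> \<open>\<open>w\<close> acts as a translation or as a reflection according to the
    parity of its letters \<open>i\<close> and \<open>j\<close> together. Each letter
    \<open>j\<close> changes the parity of \<open>c\<close>, while a letter \<open>i\<close> changes
    only its sign.\<close>
  have "\<exists>c. odd c = par w j \<and> psi i j w = (\<lambda>x. if par w i = par w j then x + c else c - x)"
    using w(1)
  proof (induction w rule: left_induct)
    case one
    then show ?case by (intro exI[of _ 0]) (auto simp: psi_simps[OF ij])
  next
    case (mult k w)
    then obtain c where c: "odd c = par w j" "psi i j w = (\<lambda>x. if par w i = par w j then x + c else c - x)"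
      by blast
    have "psi i j (s k \<otimes> w) = (\<lambda>x. if k = i then - psi i j w x else if k = j then 1 - psi i j w x else psi i j w x)"
      using mult.hyps by (simp add: psi_simps[OF ij] fun_eq_iff)
    moreover have "i \<noteq> j" using ij by auto
    ultimately show ?case
      using c mult.hyps
      by (intro exI[of _ "if k = i then - c else if k = j then 1 - c else c"]) auto
  qed
  then obtain c where "odd c" "psi i j w = (\<lambda>x. x + c)"
    using p by auto
  moreover have "psi i j w (psi i j w 0) = 0"
    using w by (metis psi_simps(1,3)[OF ij])
  ultimately show False by auto
qed

subsection \<open>Walls\<close>

text \<open>\<open>D w t\<close> means that the wall of the reflection \<open>t\<close> separates the chambers \<open>\<one>\<close> and \<open>w\<close>. It is
  obtained from an action of the group on reflections with a sign.\<close>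

definition D :: "nat word set \<Rightarrow> nat word set \<Rightarrow> bool"
  where "D w t = snd (act (\<lambda>i (t, b). if t \<in> carrier G then (s i \<otimes> t \<otimes> s i, b \<noteq> (t = s i)) else (t, b))
    (inv w) (t, False))"

lemma mult_s_eq_one_iff [simp]: "i \<in> I \<Longrightarrow> t \<in> carrier G \<Longrightarrow> t \<otimes> s i = \<one> \<longleftrightarrow> t = s i"
  by (metis s_closed s_inv s_sq inv_equality inv_inv)

lemma conj_s_eq_iff:
  assumes "i \<in> I" "j \<in> I" "\<not> adj i j" "t \<in> carrier G"
  shows "s i \<otimes> (t \<otimes> s i) = s j \<longleftrightarrow> t = s j"
proof
  assume "s i \<otimes> (t \<otimes> s i) = s j"
  then have "s i \<otimes> (s i \<otimes> (t \<otimes> s i) \<otimes> s i) = s i \<otimes> (s j \<otimes> s i)" by simp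
  then show "t = s j" using assms by (simp add: grp s_comm[of j i])
next
  assume "t = s j"
  then show "s i \<otimes> (t \<otimes> s i) = s j" using assms by (simp add: s_comm[of j i])
qed

text \<open>The sign changes only at \<open>t = s i\<close>, and conjugation by a commuting
  \<open>s j\<close> fixes \<open>s i\<close>; so two commuting letters change the same signs in
  either order.\<close>

lemma D_action:
  "twin_action (\<lambda>i (t, b). if t \<in> carrier G then (s i \<otimes> t \<otimes> s i, b \<noteq> (t = s i)) else (t, b))"
proof -
  have sq: "s i \<otimes> (s i \<otimes> t \<otimes> s i) \<otimes> s i = t" "s i \<otimes> t \<otimes> s i = s i \<longleftrightarrow> t = s i"
    if "i \<in> I" "t \<in> carrier G" for i t
    using that by (simp_all add: grp)
  have comm: "s i \<otimes> (s j \<otimes> t \<otimes> s j) \<otimes> s i = s j \<otimes> (s i \<otimes> t \<otimes> s i) \<otimes> s j"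
    "s i \<otimes> t \<otimes> s i = s j \<longleftrightarrow> t = s j" "s j \<otimes> t \<otimes> s j = s i \<longleftrightarrow> t = s i"
    if "i \<in> I" "j \<in> I" "\<not> adj i j" "t \<in> carrier G" for i j t
    using that conj_s_eq_iff[of i j t] conj_s_eq_iff[of j i t]
    by (simp_all add: grp s_comm[of j i] s_comm_left[of j i])
  show ?thesis
    unfolding twin_action_def using sq comm by auto
qed

lemma D_act:
  assumes "w \<in> carrier G" "t \<in> carrier G"
  shows "act (\<lambda>i (t, b). if t \<in> carrier G then (s i \<otimes> t \<otimes> s i, b \<noteq> (t = s i)) else (t, b)) w (t, b)
    = (w \<otimes> t \<otimes> inv w, b \<noteq> D (inv w) t)"
  (is "act ?f w _ = _")
proof -
  have "\<exists>d. \<forall>b. act ?f w (t, b) = (w \<otimes> t \<otimes> inv w, b \<noteq> d)"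
    using assms
  proof (induction w rule: left_induct)
    case one
    then show ?case by (auto simp: act_one[OF D_action])
  next
    case (mult i w)
    then obtain d where "\<forall>b. act ?f w (t, b) = (w \<otimes> t \<otimes> inv w, b \<noteq> d)" by blast
    with mult show ?case
      by (intro exI[of _ "d \<noteq> (w \<otimes> t \<otimes> inv w = s i)"])
        (auto simp: act_mult[OF D_action] act_s[OF D_action] grp)
  qed
  then show ?thesis
    using assms by (auto simp: D_def)
qed

lemma D_one [simp]: "\<not> D \<one> t"
  by (simp add: D_def act_one[OF D_action])

lemma D_s [simp]: "i \<in> I \<Longrightarrow> t \<in> carrier G \<Longrightarrow> D (s i) t \<longleftrightarrow> t = s i"
  by (simp add: D_def act_s[OF D_action])

text \<open>The cocycle rule: a path from \<one> to \<open>u \<otimes> v\<close> may pass through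
  \<open>u\<close>, and translation by \<open>inv u\<close> carries its second half to a path from
  \<one> to \<open>v\<close>. Crossing a wall in both halves leaves it on the original side.\<close>

lemma D_mult:
  assumes "u \<in> carrier G" "v \<in> carrier G" "t \<in> carrier G"
  shows "D (u \<otimes> v) t \<longleftrightarrow> D u t \<noteq> D v (inv u \<otimes> t \<otimes> u)"
proof -
  have "D (u \<otimes> v) t = snd (act (\<lambda>i (t, b). if t \<in> carrier G then (s i \<otimes> t \<otimes> s i, b \<noteq> (t = s i)) else (t, b))
    (inv v \<otimes> inv u) (t, False))"
    using assms by (simp add: D_def inv_mult_group)
  also have "\<dots> \<longleftrightarrow> D u t \<noteq> D v (inv u \<otimes> t \<otimes> u)"
    using assms by (subst act_mult[OF D_action]) (simp_all add: D_act)
  finally show ?thesis .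
qed

lemma D_s_mult:
  "i \<in> I \<Longrightarrow> w \<in> carrier G \<Longrightarrow> t \<in> carrier G \<Longrightarrow>
    D (s i \<otimes> w) t \<longleftrightarrow> (t = s i) \<noteq> D w (s i \<otimes> t \<otimes> s i)"
  by (simp add: D_mult)

subsection \<open>Word length\<close>

definition ev :: "nat list \<Rightarrow> nat word set"
  where "ev l = foldr (\<lambda>i x. s i \<otimes> x) l \<one>"

lemma ev_simps [simp]: "ev [] = \<one>" "ev (i # l) = s i \<otimes> ev l"
  by (simp_all add: ev_def)

lemma ev_closed [simp]: "set l \<subseteq> I \<Longrightarrow> ev l \<in> carrier G"
  by (induction l) auto

lemma ev_append: "set k \<subseteq> I \<Longrightarrow> set l \<subseteq> I \<Longrightarrow> ev (k @ l) = ev k \<otimes> ev l"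
  by (induction k) (auto simp: m_assoc)

lemma ev_rev: "set l \<subseteq> I \<Longrightarrow> ev (rev l) = inv (ev l)"
  by (induction l) (auto simp: ev_append inv_mult_group)

definition len :: "nat word set \<Rightarrow> nat"
  where "len w = (LEAST k. \<exists>l. set l \<subseteq> I \<and> length l = k \<and> ev l = w)"

lemma len_le: "set l \<subseteq> I \<Longrightarrow> len (ev l) \<le> length l"
  unfolding len_def by (rule Least_le) auto

lemma len_word:
  assumes "w \<in> carrier G"
  obtains l where "set l \<subseteq> I" "length l = len w" "ev l = w"
proof -
  have "\<exists>l. set l \<subseteq> I \<and> ev l = w"
    using assms
  proof (induction w rule: left_induct)
    case one
    show ?case by (intro exI[of _ "[]"]) simp
  next
    case (mult i w)
    then obtain l where "set l \<subseteq> I" "ev l = w" by blast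
    then show ?case using mult by (intro exI[of _ "i # l"]) simp
  qed
  then have "\<exists>k l. set l \<subseteq> I \<and> length l = k \<and> ev l = w" by blast
  from LeastI_ex[OF this] show ?thesis
    using that unfolding len_def by blast
qed

text \<open>The strong exchange condition. A wall that separates \<one> from the end of a word is
  crossed at one of its letters, and deleting that letter amounts to multiplying by \<open>t\<close>
  from the left.\<close>

lemma delete_letter:
  assumes "set l \<subseteq> I" "t \<in> carrier G" "D (ev l) t"
  shows "\<exists>l'. set l' \<subseteq> I \<and> Suc (length l') = length l \<and> ev l' = t \<otimes> ev l"
  using assms
proof (induction l arbitrary: t)
  case (Cons i l)
  show ?case
  proof (cases "t = s i")
    case True
    then show ?thesis using Cons.prems by (intro exI[of _ l]) simp
  next
    case False
    then have "D (ev l) (s i \<otimes> t \<otimes> s i)"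
      using Cons.prems by (simp add: D_s_mult)
    then obtain l' where "set l' \<subseteq> I" "Suc (length l') = length l"
        "ev l' = s i \<otimes> t \<otimes> s i \<otimes> ev l"
      using Cons.IH[of "s i \<otimes> t \<otimes> s i"] Cons.prems by auto
    then show ?thesis
      using Cons.prems by (intro exI[of _ "i # l'"]) (simp add: m_assoc)
  qed
qed simp

lemma len_less:
  assumes "w \<in> carrier G" "t \<in> carrier G" "D w t"
  shows "len (t \<otimes> w) < len w"
proof -
  obtain l where l: "set l \<subseteq> I" "length l = len w" "ev l = w"
    using len_word assms(1) by blast
  then obtain l' where "set l' \<subseteq> I" "Suc (length l') = length l" "ev l' = t \<otimes> w"
    using delete_letter[of l t] assms by auto
  then show ?thesis
    using len_le[of l'] l by simp
qed

text \<open>The first letter of a shortest word is a descent: otherwise its wall would separate the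
  rest of the word from \<one>, and prefixing the letter would shorten that rest.\<close>

lemma descent_ex:
  assumes "w \<in> carrier G" "w \<noteq> \<one>"
  obtains i where "i \<in> I" "D w (s i)"
proof -
  obtain l where l: "set l \<subseteq> I" "length l = len w" "ev l = w"
    using len_word assms(1) by blast
  then obtain i k where k: "l = i # k" "i \<in> I" "set k \<subseteq> I"
    using assms(2) by (cases l) auto
  have "D w (s i)"
  proof (rule ccontr)
    assume "\<not> D w (s i)"
    then have "D (ev k) (s i)"
      using l k by (auto simp: D_s_mult)
    then have "len w < len (ev k)"
      using len_less[of "ev k" "s i"] k l by auto
    then show False
      using len_le[of k] k l by simp
  qed
  then show ?thesis using that k by blast
qed

text \<open>Induction along reduced words. Unlike \<open>left_induct\<close>, it records that the
  new letter moves away from \<one>, on which the arguments about centralizers and ping-pong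
  rely.\<close>

lemma descent_induct [consumes 1, case_names one descent]:
  assumes "w \<in> carrier G" "P \<one>"
    and "\<And>i w. i \<in> I \<Longrightarrow> w \<in> carrier G \<Longrightarrow> D (s i \<otimes> w) (s i) \<Longrightarrow> P w \<Longrightarrow> P (s i \<otimes> w)"
  shows "P w"
  using assms(1)
proof (induction "len w" arbitrary: w rule: less_induct)
  case less
  show ?case
  proof (cases "w = \<one>")
    case False
    then obtain i where i: "i \<in> I" "D w (s i)"
      using descent_ex less.prems by blast
    then have "P (s i \<otimes> w)"
      using less len_less[of w "s i"] by simp
    then show ?thesis
      using assms(3)[of i "s i \<otimes> w"] i less.prems by simp
  qed (simp add: assms(2))
qed

subsection \<open>Descents and centralizers of generators\<close>

primrec alt :: "nat \<Rightarrow> nat \<Rightarrow> nat \<Rightarrow> nat list"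
  where "alt i j 0 = []"
  | "alt i j (Suc k) = i # alt j i k"

lemma alt_closed [simp]: "i \<in> I \<Longrightarrow> j \<in> I \<Longrightarrow> ev (alt i j k) \<in> carrier G"
  by (induction k arbitrary: i j) auto

lemma alt_ex: "i \<in> I \<Longrightarrow> j \<in> I \<Longrightarrow> set l \<subseteq> {i, j} \<Longrightarrow> \<exists>k. ev l = ev (alt i j k) \<or> ev l = ev (alt j i k)"
proof (induction l)
  case (Cons a l)
  have "\<exists>k. s i \<otimes> ev l = ev (alt i j k) \<or> s i \<otimes> ev l = ev (alt j i k)"
    if "ev l = ev (alt i j k) \<or> ev l = ev (alt j i k)" and ij: "i \<in> I" "j \<in> I" for i j k
    using that(1)
  proof
    assume l: "ev l = ev (alt i j k)"
    show ?thesis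
    proof (cases k)
      case 0
      then show ?thesis using l by (intro exI[of _ 1]) simp
    next
      case (Suc k')
      then show ?thesis using l Suc ij by (intro exI[of _ k']) simp
    qed
  next
    assume "ev l = ev (alt j i k)"
    then show ?thesis by (intro exI[of _ "Suc k"]) simp
  qed
  note step = this
  obtain k where k: "ev l = ev (alt i j k) \<or> ev l = ev (alt j i k)"
    using Cons by auto
  show ?case
  proof (cases "a = i")
    case True
    then show ?thesis using step[OF k] Cons.prems by simp
  next
    case False
    then have "a = j" using Cons.prems by simp
    then show ?thesis using step[of j i k] k Cons.prems by auto
  qed
qed (auto intro!: exI[of _ 0])

text \<open>The reflections separating an alternating word from the identity are mapped by \<open>psi\<close> to the
  reflections of the integers at points on one side of \<open>1/4\<close>.\<close>

lemma D_alt: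
  assumes "i \<in> I" "j \<in> I" "adj i j" "t \<in> carrier G"
  shows "(D (ev (alt i j k)) t \<longrightarrow> (\<exists>c\<le>0. psi i j t = (\<lambda>y. c - y))) \<and>
         (D (ev (alt j i k)) t \<longrightarrow> (\<exists>c\<ge>1. psi i j t = (\<lambda>y. c - y)))"
  using assms(4)
proof (induction k arbitrary: t)
  case (Suc k)
  have cl: "ev (alt i j k) \<in> carrier G" "ev (alt j i k) \<in> carrier G"
    using assms(1,2) by simp_all
  have ij: "i \<noteq> j" using assms(3) by auto
  have psi_conj: "psi i j t y = psi i j (s a) (psi i j (s a \<otimes> t \<otimes> s a) (psi i j (s a) y))"
    if "a \<in> I" for a y
  proof -
    have "psi i j (s a \<otimes> ((s a \<otimes> t \<otimes> s a) \<otimes> s a)) y =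
        psi i j (s a) (psi i j (s a \<otimes> t \<otimes> s a) (psi i j (s a) y))"
      using that Suc.prems psi_simps(3)[OF assms(3)] by (simp del: s_cancel)
    then show ?thesis
      using that Suc.prems by (simp add: m_assoc)
  qed
  have psi_s: "psi i j (s i) y = - y" "psi i j (s j) y = 1 - y" for y
    using assms ij by (simp_all add: psi_simps[OF assms(3)])
  have "\<exists>c\<le>0. psi i j t = (\<lambda>y. c - y)" if "D (ev (alt i j (Suc k))) t"
  proof (cases "t = s i")
    case True
    then show ?thesis using psi_s by (intro exI[of _ 0]) auto
  next
    case False
    then have "D (ev (alt j i k)) (s i \<otimes> t \<otimes> s i)"
      using that cl assms Suc.prems by (simp add: D_s_mult)
    then obtain c where "c \<ge> 1" "psi i j (s i \<otimes> t \<otimes> s i) = (\<lambda>y. c - y)"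
      using Suc.IH[of "s i \<otimes> t \<otimes> s i"] Suc.prems assms by auto
    then show ?thesis
      using psi_conj[OF assms(1)] psi_s by (intro exI[of _ "- c"]) (simp add: fun_eq_iff)
  qed
  moreover have "\<exists>c\<ge>1. psi i j t = (\<lambda>y. c - y)" if "D (ev (alt j i (Suc k))) t"
  proof (cases "t = s j")
    case True
    then show ?thesis using psi_s by (intro exI[of _ 1]) auto
  next
    case False
    then have "D (ev (alt i j k)) (s j \<otimes> t \<otimes> s j)"
      using that cl assms Suc.prems by (simp add: D_s_mult)
    then obtain c where "c \<le> 0" "psi i j (s j \<otimes> t \<otimes> s j) = (\<lambda>y. c - y)"
      using Suc.IH[of "s j \<otimes> t \<otimes> s j"] Suc.prems assms by auto
    then show ?thesis
      using psi_conj[OF assms(2)] psi_s by (intro exI[of _ "2 - c"]) (simp add: fun_eq_iff)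
  qed
  ultimately show ?case by blast
qed simp

text \<open>Write \<open>u = x y\<close> with \<open>x\<close> in the parabolic subgroup of \<open>i\<close> and \<open>j\<close> and \<open>y\<close> of minimal length in
  its coset: no reflection of that subgroup separates \<open>y\<close> from \<open>\<one>\<close>, so \<open>u\<close> may be replaced by \<open>x\<close>.\<close>

lemma descents_commute:
  assumes u: "u \<in> carrier G" and ij: "i \<in> I" "j \<in> I" "adj i j"
    and D: "D u (s i)" "D u (s j)"
  shows False
proof -
  obtain l where l: "set l \<subseteq> {i, j}"
    and min: "\<And>k. set k \<subseteq> {i, j} \<Longrightarrow> len (ev l \<otimes> u) \<le> len (ev k \<otimes> u)"
    using ex_has_least_nat[of "\<lambda>l. set l \<subseteq> {i, j}" "[]" "\<lambda>l. len (ev l \<otimes> u)"] by auto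
  have lI: "set k \<subseteq> I" if "set k \<subseteq> {i, j}" for k
    using that ij by auto
  define x y where "x = ev (rev l)" and "y = ev l \<otimes> u"
  have cl: "x \<in> carrier G" "y \<in> carrier G" and x: "x = inv (ev l)"
    using lI[OF l] u by (simp_all add: x_def y_def ev_rev)
  have "\<not> D y (ev k)" if k: "set k \<subseteq> {i, j}" for k
  proof
    assume "D y (ev k)"
    then have "len (ev k \<otimes> y) < len y"
      using cl lI[OF k] by (intro len_less) auto
    then show False
      using min[of "k @ l"] k l lI[OF l] lI[OF k] u by (simp add: y_def ev_append m_assoc)
  qed
  then have "\<not> D y (inv x \<otimes> s a \<otimes> x)" if "a \<in> {i, j}" for a
  proof -
    have "ev (l @ [a] @ rev l) = inv x \<otimes> s a \<otimes> x"
      using that ij lI[OF l] by (auto simp: x ev_append ev_rev m_assoc)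
    then show ?thesis
      using that l \<open>\<And>k. set k \<subseteq> {i, j} \<Longrightarrow> \<not> D y (ev k)\<close>[of "l @ [a] @ rev l"] by auto
  qed
  moreover have "u = x \<otimes> y"
    using lI[OF l] u by (simp add: x y_def)
  ultimately have Dx: "D x (s i)" "D x (s j)"
    using D D_mult[OF cl] ij by auto
  obtain k where "x = ev (alt i j k) \<or> x = ev (alt j i k)"
    using alt_ex[of i j "rev l"] l ij by (auto simp: x_def)
  \<comment> \<open>\<open>s i\<close> is the reflection with \<open>c = 0\<close> and
    \<open>s j\<close> the one with \<open>c = 1\<close>, so an alternating word is separated from
    \<one> by at most one of the two walls.\<close>
  then show False
  proof
    assume "x = ev (alt i j k)"
    then obtain c where "c \<le> 0" "psi i j (s j) = (\<lambda>y. c - y)"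
      using D_alt[of i j "s j" k] ij Dx by auto
    then show False
      using ij psi_simps(2)[OF ij(3), of j 0] by auto
  next
    assume "x = ev (alt j i k)"
    then obtain c where "c \<ge> 1" "psi i j (s i) = (\<lambda>y. c - y)"
      using D_alt[of i j "s i" k] ij Dx by auto
    then show False
      using ij psi_simps(2)[OF ij(3), of i 0] by auto
  qed
qed

lemma conj_s_index:
  assumes "g \<in> carrier G" "i \<in> I" "j \<in> I" "g \<otimes> s i \<otimes> inv g = s j"
  shows "i = j"
  using par_conj[of g "s i" j] assms by simp

lemma conj_eq_iff:
  "g \<in> carrier G \<Longrightarrow> t \<in> carrier G \<Longrightarrow> t' \<in> carrier G \<Longrightarrow>
    inv g \<otimes> t \<otimes> g = t' \<longleftrightarrow> t = g \<otimes> t' \<otimes> inv g"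
  by (auto simp: m_assoc)

text \<open>Since \<open>u\<close> does not carry the wall of \<open>s j\<close> to that of
  \<open>s i\<close>, the letter \<open>i\<close> is also a descent of
  \<open>u \<otimes> s j = s j \<otimes> u\<close>. But \<open>j\<close> is a descent of one of
  \<open>u\<close> and \<open>s j \<otimes> u\<close>, which would then have two adjacent
  descents.\<close>

lemma centralizer_descent:
  assumes u: "u \<in> carrier G" and ij: "i \<in> I" "j \<in> I"
    and c: "u \<otimes> s j = s j \<otimes> u" and D: "D u (s i)"
  shows "\<not> adj i j"
proof
  assume adj: "adj i j"
  have "inv u \<otimes> s i \<otimes> u \<noteq> s j"
    using conj_s_index[of u j i] u ij adj by (auto simp: conj_eq_iff)
  then have "D (u \<otimes> s j) (s i)"
    using D u ij by (simp add: D_mult)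
  moreover have "D (s j \<otimes> u) (s j) \<or> D u (s j)"
    using u ij by (simp add: D_s_mult)
  ultimately show False
    using descents_commute[of u i j] descents_commute[of "s j \<otimes> u" i j] c u ij adj D by auto
qed

text \<open>Every descent of \<open>u\<close> commutes with \<open>s j\<close>, so removing it stays
  inside the centralizer. Hence the centralizer of \<open>s j\<close> is generated by the generators
  commuting with \<open>s j\<close>.\<close>

lemma centralizer_induct [consumes 3, case_names one descent]:
  assumes "u \<in> carrier G" "j \<in> I" "u \<otimes> s j = s j \<otimes> u" "P \<one>"
    and step: "\<And>i u. i \<in> I \<Longrightarrow> u \<in> carrier G \<Longrightarrow> u \<otimes> s j = s j \<otimes> u \<Longrightarrow> \<not> adj i j \<Longrightarrow>
      D (s i \<otimes> u) (s i) \<Longrightarrow> P u \<Longrightarrow> P (s i \<otimes> u)"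
  shows "P u"
  using assms(1,3)
proof (induction u rule: descent_induct)
  case (descent i u)
  then have adj: "\<not> adj i j"
    using centralizer_descent[of "s i \<otimes> u" i j] assms(2) by simp
  have "s i \<otimes> (s i \<otimes> u \<otimes> s j) = s i \<otimes> (s j \<otimes> (s i \<otimes> u))"
    using descent.prems by simp
  then have "u \<otimes> s j = s j \<otimes> u"
    using descent.hyps assms(2) adj by (simp add: m_assoc s_comm_left[of i j])
  then show ?case
    using descent adj step by blast
qed (rule assms(4))

text \<open>A reduced word for \<open>u\<close> has only letters that commute with
  \<open>s j\<close>, and each wall it crosses is a conjugate of such a letter by such
  letters.\<close>

lemma centralizer_D:
  assumes "u \<in> carrier G" "j \<in> I" "u \<otimes> s j = s j \<otimes> u" "t \<in> carrier G" "D u t"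
  shows "t \<otimes> s j = s j \<otimes> t"
  using assms(1-3) assms(4-)
proof (induction arbitrary: t rule: centralizer_induct)
  case (descent i u)
  show ?case
  proof (cases "t = s i")
    case True
    then show ?thesis using descent assms(2) by (simp add: s_comm[of i j])
  next
    case False
    then have "D u (s i \<otimes> t \<otimes> s i)"
      using descent by (simp add: D_s_mult)
    then have "s i \<otimes> t \<otimes> s i \<otimes> s j = s j \<otimes> (s i \<otimes> t \<otimes> s i)"
      using descent.IH[of "s i \<otimes> t \<otimes> s i"] descent.hyps descent.prems by simp
    then have "s i \<otimes> (s i \<otimes> t \<otimes> s i \<otimes> s j) \<otimes> s i = s i \<otimes> (s j \<otimes> (s i \<otimes> t \<otimes> s i)) \<otimes> s i"
      by simp
    then show ?thesis
      using descent.hyps descent.prems assms(2)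
      by (simp add: m_assoc s_comm_left[of i j] s_comm[of i j])
  qed
qed simp

text \<open>A letter \<open>j\<close> in a reduced word for \<open>u\<close> could be moved to the
  front past the commuting letters and would be a descent.\<close>

lemma centralizer_par:
  assumes "u \<in> carrier G" "j \<in> I" "u \<otimes> s j = s j \<otimes> u" "\<not> D u (s j)"
  shows "\<not> par u j"
  using assms(1-3) assms(4-)
proof (induction rule: centralizer_induct)
  case (descent i u)
  have "i \<noteq> j" using descent by auto
  moreover have "s i \<otimes> s j \<otimes> s i = s j"
    using descent assms(2) by (simp add: s_comm[of i j] m_assoc)
  moreover have "s i = s j \<longleftrightarrow> i = j"
    using descent assms(2) par_s by metis
  ultimately show ?case
    using descent assms(2) by (auto simp: D_s_mult)
qed simp

subsection \<open>Reflections\<close>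

definition refl :: "nat word set \<Rightarrow> bool"
  where "refl t \<longleftrightarrow> (\<exists>g\<in>carrier G. \<exists>i\<in>I. t = g \<otimes> s i \<otimes> inv g)"

lemma reflE:
  assumes "refl t"
  obtains g i where "g \<in> carrier G" "i \<in> I" "t = g \<otimes> s i \<otimes> inv g"
  using assms by (auto simp: refl_def)

lemma refl_closed: "refl t \<Longrightarrow> t \<in> carrier G"
  by (auto simp: refl_def)

lemma refl_sq: "refl t \<Longrightarrow> t \<otimes> t = \<one>"
  by (auto simp: refl_def m_assoc)

lemma refl_inv: "refl t \<Longrightarrow> inv t = t"
  by (simp add: refl_closed refl_sq inv_equality)

text \<open>Conjugation by the reflection fixes \<open>t\<close>, so the contributions of
  \<open>g\<close> and of \<open>inv g\<close> to the cocycle cancel and only the middle letter can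
  cross the wall of \<open>t\<close>.\<close>

lemma D_conj_s:
  assumes "g \<in> carrier G" "i \<in> I" "t \<in> carrier G"
    and c: "inv g \<otimes> t \<otimes> g \<otimes> s i = s i \<otimes> (inv g \<otimes> t \<otimes> g)"
  shows "D (g \<otimes> s i \<otimes> inv g) t \<longleftrightarrow> t = g \<otimes> s i \<otimes> inv g"
proof -
  define t' where "t' = inv g \<otimes> t \<otimes> g"
  have t'_closed: "t' \<in> carrier G" and c': "t' \<otimes> s i = s i \<otimes> t'"
    using assms(1-3) c by (simp_all add: t'_def)
  then have t': "t' \<in> carrier G" "s i \<otimes> t' \<otimes> s i = t'"
    using assms(2) by (simp_all add: m_assoc)
  have "D g t = D (inv g) t'"
    using D_mult[of g "inv g" t] assms(1-3) by (simp add: t'_def)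
  moreover have "D (g \<otimes> (s i \<otimes> inv g)) t \<longleftrightarrow> D g t \<noteq> ((t' = s i) \<noteq> D (inv g) (s i \<otimes> t' \<otimes> s i))"
    using assms t'(1) by (simp add: D_mult[of g "s i \<otimes> inv g"] D_s_mult t'_def[symmetric])
  moreover have "t' = s i \<longleftrightarrow> t = g \<otimes> s i \<otimes> inv g"
    using assms by (simp add: t'_def conj_eq_iff)
  ultimately show ?thesis
    using assms(1-3) t' by (auto simp: m_assoc)
qed

lemma D_refl:
  assumes "refl t" "t' \<in> carrier G" "t \<otimes> t' = t' \<otimes> t"
  shows "D t t' \<longleftrightarrow> t' = t"
proof -
  obtain g i where g: "g \<in> carrier G" "i \<in> I" "t = g \<otimes> s i \<otimes> inv g"
    using assms(1) by (rule reflE)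
  have "inv g \<otimes> (t \<otimes> t') \<otimes> g = inv g \<otimes> (t' \<otimes> t) \<otimes> g"
    using assms(3) by simp
  then have "inv g \<otimes> t' \<otimes> g \<otimes> s i = s i \<otimes> (inv g \<otimes> t' \<otimes> g)"
    using g assms(2) by (simp add: m_assoc)
  then show ?thesis
    using D_conj_s[of g i t'] g assms(2) by simp
qed

lemma D_refl_mult:
  assumes t: "refl t" and w: "w \<in> carrier G" and t': "t' \<in> carrier G" "t \<otimes> t' = t' \<otimes> t"
  shows "D (t \<otimes> w) t' \<longleftrightarrow> D w t' \<noteq> (t' = t)"
proof -
  have "t \<otimes> t' \<otimes> t = t'"
    using t t' by (simp add: t'(2) m_assoc refl_closed refl_sq)
  then show ?thesis
    using assms D_mult[of t w t'] D_refl[of t t'] by (auto simp: refl_closed refl_inv)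
qed

text \<open>The elements \<one>, \<open>t\<close>, \<open>t'\<close> and
  \<open>t \<otimes> t'\<close> represent the four quadrants, because the reflection in one of two
  crossing walls keeps the sides of the other.\<close>

lemma quadrants:
  assumes "refl t" "refl t'" "t \<otimes> t' = t' \<otimes> t" "t \<noteq> t'"
  obtains u where "u \<in> carrier G" "D u t = a" "D u t' = b"
proof -
  define u where "u = (if a then t else \<one>) \<otimes> ((if b then t' else \<one>) \<otimes> \<one>)"
  have "u \<in> carrier G" "D u t = a" "D u t' = b"
    using assms by (auto simp: u_def refl_closed D_refl_mult D_refl)
  then show ?thesis by (rule that)
qed

text \<open>\<open>i\<close> is a descent of \<open>inv u \<otimes> v\<close>. The step from
  \<open>u\<close> to \<open>u \<otimes> s i\<close> crosses a single wall, and this wall separates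
  \<open>u\<close> from \<open>v\<close>; nearest-point arguments are built from such steps.\<close>

lemma step_towards:
  assumes "u \<in> carrier G" "v \<in> carrier G" "u \<noteq> v"
  obtains i where "i \<in> I" "len (inv (u \<otimes> s i) \<otimes> v) < len (inv u \<otimes> v)"
    "\<forall>t\<in>carrier G. D (u \<otimes> s i) t \<longleftrightarrow> D u t \<noteq> (t = u \<otimes> s i \<otimes> inv u)"
    "D u (u \<otimes> s i \<otimes> inv u) \<noteq> D v (u \<otimes> s i \<otimes> inv u)"
proof -
  have "inv u \<otimes> v \<noteq> \<one>"
    using assms by (metis inv_cancel(1) r_one)
  then obtain i where i: "i \<in> I" "D (inv u \<otimes> v) (s i)"
    using assms descent_ex[of "inv u \<otimes> v"] by auto
  show ?thesis
  proof (rule that[OF i(1)])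
    show "len (inv (u \<otimes> s i) \<otimes> v) < len (inv u \<otimes> v)"
      using len_less[of "inv u \<otimes> v" "s i"] i assms by (simp add: grp)
    show "\<forall>t\<in>carrier G. D (u \<otimes> s i) t \<longleftrightarrow> D u t \<noteq> (t = u \<otimes> s i \<otimes> inv u)"
      using i assms by (simp add: D_mult conj_eq_iff)
    have "D (u \<otimes> (inv u \<otimes> v)) (u \<otimes> s i \<otimes> inv u) \<longleftrightarrow>
        D u (u \<otimes> s i \<otimes> inv u) \<noteq> D (inv u \<otimes> v) (inv u \<otimes> (u \<otimes> s i \<otimes> inv u) \<otimes> u)"
      using assms i by (intro D_mult) auto
    also have "inv u \<otimes> (u \<otimes> s i \<otimes> inv u) \<otimes> u = s i"
      using assms i by (simp add: m_assoc)
    finally show "D u (u \<otimes> s i \<otimes> inv u) \<noteq> D v (u \<otimes> s i \<otimes> inv u)"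
      using i assms by simp
  qed
qed

text \<open>A minimal path between the two sides of the wall of \<open>s i\<close> crosses that wall inside the
  centralizer of \<open>s i\<close>, which lies on one side of the wall of \<open>t\<close>.\<close>

lemma nested_s:
  assumes i: "i \<in> I" and t: "t \<in> carrier G" "t \<otimes> s i \<noteq> s i \<otimes> t"
    and uv: "u \<in> carrier G" "v \<in> carrier G" "D u t" "D v t"
  shows "D u (s i) = D v (s i)"
  using uv
proof (induction "len (inv u \<otimes> v)" arbitrary: u rule: less_induct)
  case less
  show ?case
  proof (cases "u = v")
    case False
    obtain k where k: "k \<in> I" "len (inv (u \<otimes> s k) \<otimes> v) < len (inv u \<otimes> v)"
      and D: "\<forall>t\<in>carrier G. D (u \<otimes> s k) t \<longleftrightarrow> D u t \<noteq> (t = u \<otimes> s k \<otimes> inv u)"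
      and sep: "D u (u \<otimes> s k \<otimes> inv u) \<noteq> D v (u \<otimes> s k \<otimes> inv u)"
      by (rule step_towards[OF less.prems(1,2) False])
    have "t \<noteq> u \<otimes> s k \<otimes> inv u"
      using sep less.prems by auto
    then have "D (u \<otimes> s k) t"
      using D less.prems(3) t(1) by blast
    then have *: "D (u \<otimes> s k) (s i) = D v (s i)"
      using less.prems k by (intro less.hyps) simp_all
    have "u \<otimes> s k \<otimes> inv u \<noteq> s i"
    proof
      assume eq: "u \<otimes> s k \<otimes> inv u = s i"
      then have "k = i"
        by (rule conj_s_index[OF less.prems(1) k(1) i])
      have "u \<otimes> s k \<otimes> inv u \<otimes> u = s i \<otimes> u"
        by (simp only: eq)
      then have "u \<otimes> s i = s i \<otimes> u"
        using \<open>k = i\<close> i less.prems(1) by (simp add: m_assoc)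
      then show False
        using centralizer_D[of u i t] i t less.prems by auto
    qed
    then have "D (u \<otimes> s k) (s i) = D u (s i)"
      using D i by auto
    with * show ?thesis by blast
  qed simp
qed

lemma nested:
  assumes "refl t" "refl t'" "t \<otimes> t' \<noteq> t' \<otimes> t"
  shows "\<exists>a b. \<forall>u\<in>carrier G. \<not> (D u t = a \<and> D u t' = b)"
proof -
  obtain g i where g: "g \<in> carrier G" "i \<in> I" "t = g \<otimes> s i \<otimes> inv g"
    using assms(1) by (rule reflE)
  have t': "t' \<in> carrier G" using assms by (simp add: refl_closed)
  define r where "r = inv g \<otimes> t' \<otimes> g"
  have r: "r \<in> carrier G" "t' = g \<otimes> r \<otimes> inv g"
    using g t' by (simp_all add: r_def m_assoc)
  have "r \<otimes> s i \<noteq> s i \<otimes> r"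
  proof
    assume "r \<otimes> s i = s i \<otimes> r"
    then have "g \<otimes> (r \<otimes> s i) \<otimes> inv g = g \<otimes> (s i \<otimes> r) \<otimes> inv g" by simp
    then show False
      using assms(3) r(1) g by (simp add: r(2) m_assoc)
  qed
  then have "D u (s i) = D v (s i)" if "u \<in> carrier G" "v \<in> carrier G" "D u r" "D v r" for u v
    using nested_s[of i r u v] that g r by simp
  \<comment> \<open>\<open>a\<close> is the side of the wall of \<open>s i\<close> that no chamber
    beyond the wall of \<open>r\<close> reaches.\<close>
  then obtain a where a: "\<And>u. u \<in> carrier G \<Longrightarrow> D u r \<Longrightarrow> D u (s i) \<noteq> a"
    by metis
  \<comment> \<open>Sides are measured from \<one>, whereas the empty quadrant was found as seen
    from \<open>g\<close>; \<open>D g t\<close> and \<open>D g t'\<close> account for the change of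
    base chamber.\<close>
  have "\<not> (D u t = (D g t \<noteq> a) \<and> D u t' = (\<not> D g t'))" if u: "u \<in> carrier G" for u
  proof -
    have "inv g \<otimes> t \<otimes> g = s i" "t \<in> carrier G"
      using g by (simp_all add: m_assoc)
    then have "D u t = (D g t \<noteq> D (inv g \<otimes> u) (s i))" "D u t' = (D g t' \<noteq> D (inv g \<otimes> u) r)"
      using D_mult[of g "inv g \<otimes> u" t] D_mult[of g "inv g \<otimes> u" t'] g u t'
      by (simp_all add: r_def)
    then show ?thesis
      using a[of "inv g \<otimes> u"] u g by auto
  qed
  then show ?thesis by blast
qed

text \<open>In a conjugate of minimal length, every descent is central in that conjugate.\<close>

lemma involution_conj:
  assumes t: "t \<in> carrier G" "t \<otimes> t = \<one>" and i: "i \<in> I" "\<And>a. par t a \<longleftrightarrow> a = i"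
  shows "\<exists>g\<in>carrier G. t = g \<otimes> s i \<otimes> inv g"
proof -
  obtain g where g: "g \<in> carrier G"
    and min: "\<And>h. h \<in> carrier G \<Longrightarrow> len (g \<otimes> t \<otimes> inv g) \<le> len (h \<otimes> t \<otimes> inv h)"
    using ex_has_least_nat[of "\<lambda>g. g \<in> carrier G" \<one> "\<lambda>g. len (g \<otimes> t \<otimes> inv g)"] by auto
  define r where "r = g \<otimes> t \<otimes> inv g"
  have r: "r \<in> carrier G" "\<And>a. par r a \<longleftrightarrow> a = i"
    using t g i by (auto simp: r_def)
  have "t \<otimes> (t \<otimes> inv g) = inv g" using t g by (simp add: m_assoc[symmetric])
  then have rr: "r \<otimes> r = \<one>"
    using t g by (simp add: r_def m_assoc)
  then have rinv: "inv r = r"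
    using r by (simp add: inv_equality)
  have comm: "r \<otimes> s k = s k \<otimes> r" if k: "k \<in> I" "D r (s k)" for k
  proof (rule ccontr)
    assume nc: "r \<otimes> s k \<noteq> s k \<otimes> r"
    \<comment> \<open>\<open>D r q\<close> will say that \<open>k\<close> is a descent of
      \<open>r\<close> from the right as well. Conjugation by \<open>s k\<close> then shortens
      \<open>r\<close> at both ends, against minimality.\<close>
    define q where "q = r \<otimes> s k \<otimes> r"
    have q: "q \<in> carrier G" "r \<otimes> q \<otimes> r = s k"
      using r k rr by (simp_all add: q_def m_assoc) (simp add: m_assoc[symmetric])
    have "\<not> D (r \<otimes> r) q" using rr by simp
    then have "D r q"
      using k r q by (simp add: D_mult rinv)
    have "q \<noteq> s k"
    proof
      assume "q = s k"
      then have "r \<otimes> s k \<otimes> r \<otimes> r = s k \<otimes> r" by (simp add: q_def)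
      then show False using nc r k rr by (simp add: m_assoc)
    qed
    then have "s k \<otimes> q \<otimes> s k \<noteq> s k"
      using k q by (simp add: m_assoc)
    then have "D (s k \<otimes> r) (s k \<otimes> q \<otimes> s k)"
      using k q r \<open>D r q\<close> by (simp add: D_s_mult m_assoc)
    then have "len (s k \<otimes> q \<otimes> s k \<otimes> (s k \<otimes> r)) < len (s k \<otimes> r)"
      using k q r by (intro len_less) auto
    also have "s k \<otimes> q \<otimes> s k \<otimes> (s k \<otimes> r) = s k \<otimes> r \<otimes> s k"
      using k q r rr by (simp add: q_def m_assoc)
    also have "\<dots> = (s k \<otimes> g) \<otimes> t \<otimes> inv (s k \<otimes> g)"
      using k g t by (simp add: r_def grp)
    finally have "len ((s k \<otimes> g) \<otimes> t \<otimes> inv (s k \<otimes> g)) < len (s k \<otimes> r)" .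
    also have "\<dots> < len r"
      using len_less[of r "s k"] k r by simp
    finally show False
      using min[of "s k \<otimes> g"] k g by (simp add: r_def)
  qed
  have "r \<noteq> \<one>" using r(2)[of i] by auto
  then obtain k where k: "k \<in> I" "D r (s k)"
    using descent_ex r by blast
  \<comment> \<open>\<open>x\<close> centralizes \<open>s k\<close> and lies on the same side of its
    wall as \<one>, so it is even in \<open>k\<close>. Thus \<open>r\<close> is odd in
    \<open>k\<close>, which forces \<open>k = i\<close>.\<close>
  define x where "x = s k \<otimes> r"
  have x: "x \<in> carrier G" "r = s k \<otimes> x" "x \<otimes> s k = s k \<otimes> x" "\<not> D x (s k)"
    using k r comm[OF k] by (simp_all add: x_def m_assoc D_s_mult)
  have "k = i"
    using centralizer_par[of x k] x k r(2)[of k] by simp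
  \<comment> \<open>A descent \<open>l\<close> of \<open>x\<close> would be a second descent of
    \<open>r\<close>, and the same argument would make \<open>r\<close> odd in \<open>l\<close>,
    contrary to its parity vector.\<close>
  have "x = \<one>"
  proof (rule ccontr)
    assume "x \<noteq> \<one>"
    then obtain l where l: "l \<in> I" "D x (s l)"
      using descent_ex x by blast
    then have nadj: "\<not> adj l k"
      using centralizer_descent[of x l k] x k by simp
    have "l \<noteq> k" using l x by auto
    moreover have "s l = s k \<longleftrightarrow> l = k"
      using k l par_s by metis
    ultimately have "D r (s l)"
      using l k x nadj by (simp add: D_s_mult s_comm[of k l] m_assoc)
    then have "r \<otimes> s l = s l \<otimes> r"
      using comm l by simp
    then have "s k \<otimes> (x \<otimes> s l) = s k \<otimes> (s l \<otimes> x)"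
      using x l k nadj by (simp add: m_assoc s_comm_left[of k l])
    then have "x \<otimes> s l = s l \<otimes> x"
      using x l k by simp
    moreover have "\<not> D (s l \<otimes> x) (s l)"
      using x l by (simp add: D_s_mult)
    moreover have "s l \<otimes> x \<otimes> s l = s l \<otimes> (s l \<otimes> x)"
      using calculation(1) x l by (simp add: m_assoc)
    ultimately have "\<not> par (s l \<otimes> x) l"
      using centralizer_par[of "s l \<otimes> x" l] x l by simp
    then have "par r l"
      using x l k \<open>l \<noteq> k\<close> by simp
    then show False
      using r(2)[of l] \<open>l \<noteq> k\<close> \<open>k = i\<close> by simp
  qed
  then have "r = s i"
    using x k \<open>k = i\<close> by simp
  moreover have "t = inv g \<otimes> r \<otimes> inv (inv g)"
    using t g by (simp add: r_def m_assoc)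
  ultimately have "t = inv g \<otimes> s i \<otimes> inv (inv g)"
    by simp
  then show ?thesis
    using g by blast
qed

subsection \<open>Automorphisms acting trivially on the abelianization\<close>

lemma s_eq_iff [simp]: "i \<in> I \<Longrightarrow> j \<in> I \<Longrightarrow> s i = s j \<longleftrightarrow> i = j"
  using par_s by metis

lemma s_comm_iff: "i \<in> I \<Longrightarrow> j \<in> I \<Longrightarrow> s i \<otimes> s j = s j \<otimes> s i \<longleftrightarrow> \<not> adj i j"
  using centralizer_descent[of "s i" i j] s_comm[of i j] D_s[of i "s i"] s_closed[of i] by metis

text \<open>For \<open>n \<ge> 3\<close> each index has a neighbour \<open>j\<close> in
  \<open>I\<close>, whereas no descent of an element commuting with \<open>s j\<close> is adjacent
  to \<open>j\<close>.\<close>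

lemma central_eq_one:
  assumes "n \<ge> 3" "g \<in> carrier G" "\<And>i. i \<in> I \<Longrightarrow> g \<otimes> s i = s i \<otimes> g"
  shows "g = \<one>"
proof (rule ccontr)
  assume "g \<noteq> \<one>"
  then obtain i where i: "i \<in> I" "D g (s i)"
    using descent_ex assms(2) by blast
  define j where "j = (if i = 1 then 2 else i - 1)"
  have "j \<in> I" "adj i j"
    using i(1) assms(1) by (auto simp: I_def j_def)
  then show False
    using centralizer_descent[OF assms(2) i(1) _ assms(3) i(2), of j] by metis
qed

text \<open>The walls of \<open>\<alpha> (s (i - 1))\<close> and \<open>\<alpha> (s (i + 1))\<close> cross each other and are disjoint from the
  wall of \<open>\<alpha> (s i)\<close>, so they lie on the same side of it. The intersection of these sides is
  nonempty, and by ping-pong it is a single element \<open>c\<close>, the only one with \<open>D c (\<alpha> (s i)) \<noteq> e i\<close> for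
  all \<open>i\<close>; hence each neighbour of \<open>c\<close> is separated from it by the wall of some \<open>\<alpha> (s i)\<close>.\<close>

lemma inner_of_par:
  assumes hom: "\<alpha> \<in> hom G G" and bij: "bij_betw \<alpha> (carrier G) (carrier G)"
    and par: "\<And>i a. i \<in> I \<Longrightarrow> par (\<alpha> (s i)) a \<longleftrightarrow> a = i"
  shows "\<exists>c\<in>carrier G. \<forall>i\<in>I. \<alpha> (s i) = c \<otimes> s i \<otimes> inv c"
proof -
  have \<alpha>_mult [simp]: "\<alpha> (u \<otimes> v) = \<alpha> u \<otimes> \<alpha> v" if "u \<in> carrier G" "v \<in> carrier G" for u v
    using hom_mult[OF hom] that by blast
  have \<alpha>_closed [simp]: "\<alpha> u \<in> carrier G" if "u \<in> carrier G" for u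
    using hom_in_carrier[OF hom] that by blast
  have \<alpha>_one [simp]: "\<alpha> \<one> = \<one>"
    by (rule hom_one[OF hom is_group is_group])
  define r where "r i = \<alpha> (s i)" for i
  have refl: "refl (r i)" if "i \<in> I" for i
  proof -
    have "r i \<otimes> r i = \<one>"
      using that unfolding r_def by (metis \<alpha>_mult \<alpha>_one s_closed s_sq)
    then show ?thesis
      using involution_conj[of "r i" i] that par by (auto simp: r_def refl_def)
  qed
  have comm: "r i \<otimes> r j = r j \<otimes> r i \<longleftrightarrow> \<not> adj i j" if "i \<in> I" "j \<in> I" for i j
  proof -
    have "r i \<otimes> r j = r j \<otimes> r i \<longleftrightarrow> \<alpha> (s i \<otimes> s j) = \<alpha> (s j \<otimes> s i)"
      using that by (simp add: r_def)
    also have "\<dots> \<longleftrightarrow> s i \<otimes> s j = s j \<otimes> s i"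
      using that bij by (intro inj_on_eq_iff[of \<alpha> "carrier G"]) (auto simp: bij_betw_def)
    finally show ?thesis
      using that by (simp add: s_comm_iff)
  qed
  have r_eq: "r i = r j \<longleftrightarrow> i = j" if "i \<in> I" "j \<in> I" for i j
    using par that unfolding r_def by metis
  have rc [simp]: "r i \<in> carrier G" if "i \<in> I" for i
    using refl[OF that] by (rule refl_closed)

  have "\<forall>i. \<exists>a b. i \<in> I \<longrightarrow> Suc i \<in> I \<longrightarrow> (\<forall>u\<in>carrier G. \<not> (D u (r i) = a \<and> D u (r (Suc i)) = b))"
  proof (intro allI)
    fix i
    show "\<exists>a b. i \<in> I \<longrightarrow> Suc i \<in> I \<longrightarrow> (\<forall>u\<in>carrier G. \<not> (D u (r i) = a \<and> D u (r (Suc i)) = b))"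
      using nested[OF refl refl, of i "Suc i"] comm[of i "Suc i"] by (cases "i \<in> I \<and> Suc i \<in> I") auto
  qed
  then obtain A B where AB:
    "\<And>i u. i \<in> I \<Longrightarrow> Suc i \<in> I \<Longrightarrow> u \<in> carrier G \<Longrightarrow> \<not> (D u (r i) = A i \<and> D u (r (Suc i)) = B i)"
    by metis
  \<comment> \<open>The commuting walls of \<open>r i\<close> and \<open>r (Suc (Suc i))\<close>
    have a chamber in the quadrant given by \<open>A i\<close> and \<open>B (Suc i)\<close>. There
    the side of the middle wall is neither \<open>B i\<close> nor \<open>A (Suc i)\<close>, so these
    two agree.\<close>
  have same: "A (Suc i) = B i" if "i \<in> I" "Suc i \<in> I" "Suc (Suc i) \<in> I" for i
  proof -
    have "refl (r i)" "refl (r (Suc (Suc i)))" "r i \<noteq> r (Suc (Suc i))"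
      "r i \<otimes> r (Suc (Suc i)) = r (Suc (Suc i)) \<otimes> r i"
      using that refl comm[of i "Suc (Suc i)"] r_eq[of i "Suc (Suc i)"] by auto
    then obtain u where "u \<in> carrier G" "D u (r i) = A i" "D u (r (Suc (Suc i))) = B (Suc i)"
      using quadrants by blast
    then show ?thesis
      using AB[of i u] AB[of "Suc i" u] that by auto
  qed
  \<comment> \<open>The last index has no successor and takes its value from the pair that it
    closes.\<close>
  define e where "e i = (if Suc i \<in> I then A i else B (i - 1))" for i
  have "\<not> (D u (r i) = e i \<and> D u (r (Suc i)) = e (Suc i))"
    if "i \<in> I" "Suc i \<in> I" "u \<in> carrier G" for i u
    using AB[OF that] same[of i] that by (auto simp: e_def)
  then have facing: "\<not> (D u (r i) = e i \<and> D u (r j) = e j)"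
    if "i \<in> I" "j \<in> I" "adj i j" "u \<in> carrier G" for i j u
    using that by blast

  have "\<exists>c\<in>carrier G. \<forall>i\<in>I. D c (r i) \<noteq> e i"
  proof -
    \<comment> \<open>\<open>neg u\<close> collects the walls on whose forbidden side
      \<open>u\<close> lies. If a smallest such set contained \<open>j\<close>, the chamber
      \<open>v\<close> nearest to \<open>c\<close> across the wall of \<open>r j\<close> would have
      a smaller one.\<close>
    define neg where "neg u = {i \<in> I. D u (r i) = e i}" for u
    have fin: "finite (neg u)" for u by (simp add: neg_def I_def)
    obtain c where c: "c \<in> carrier G" "\<And>u. u \<in> carrier G \<Longrightarrow> card (neg c) \<le> card (neg u)"
      using ex_has_least_nat[of "\<lambda>u. u \<in> carrier G" \<one> "\<lambda>u. card (neg u)"] by auto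
    have False if j: "j \<in> I" "D c (r j) = e j" for j
    proof -
      have "r j \<otimes> c \<in> carrier G \<and> D (r j \<otimes> c) (r j) \<noteq> e j"
        using j c refl by (simp add: D_refl_mult)
      then obtain v where v: "v \<in> carrier G" "D v (r j) \<noteq> e j"
        and min: "\<And>u. u \<in> carrier G \<Longrightarrow> D u (r j) \<noteq> e j \<Longrightarrow> len (inv v \<otimes> c) \<le> len (inv u \<otimes> c)"
        using ex_has_least_nat[of "\<lambda>v. v \<in> carrier G \<and> D v (r j) \<noteq> e j" "r j \<otimes> c"
            "\<lambda>v. len (inv v \<otimes> c)"] by auto
      have "v \<noteq> c" using v j by auto
      obtain l where l: "l \<in> I" "len (inv (v \<otimes> s l) \<otimes> c) < len (inv v \<otimes> c)"
        and Dl: "\<forall>t\<in>carrier G. D (v \<otimes> s l) t \<longleftrightarrow> D v t \<noteq> (t = v \<otimes> s l \<otimes> inv v)"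
        and "D v (v \<otimes> s l \<otimes> inv v) \<noteq> D c (v \<otimes> s l \<otimes> inv v)"
        by (rule step_towards[OF v(1) c(1) \<open>v \<noteq> c\<close>])
      have vl: "D (v \<otimes> s l) (r j) = e j"
        using min[of "v \<otimes> s l"] l v by auto
      then have rj: "r j = v \<otimes> s l \<otimes> inv v"
        using Dl j v by auto
      \<comment> \<open>\<open>v \<otimes> s l\<close> is on the forbidden sides of both
        \<open>j\<close> and \<open>k\<close>, so the two are not adjacent and their walls cross.
        Reflecting \<open>v\<close> in \<open>r k\<close> would then bring it closer to
        \<open>c\<close>, unless \<open>c\<close> too is on the forbidden side of
        \<open>k\<close>.\<close>
      have "k \<in> neg c - {j}" if k: "k \<in> neg v" for k
      proof -
        have kI: "k \<in> I" "D v (r k) = e k" using k by (auto simp: neg_def)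
        have kj: "k \<noteq> j" using kI v by auto
        have "r k \<noteq> v \<otimes> s l \<otimes> inv v"
          using r_eq[of k j] kI kj j by (simp flip: rj)
        then have "D (v \<otimes> s l) (r k) = e k"
          using bspec[OF Dl, of "r k"] kI by simp
        then have nadj: "\<not> adj j k"
          using facing[of j k "v \<otimes> s l"] vl kI j l v by auto
        have "D c (r k) = e k"
        proof (rule ccontr)
          assume ne: "D c (r k) \<noteq> e k"
          have "D (r k \<otimes> v) (r j) \<noteq> e j"
            using kI j kj v refl r_eq comm[of k j] nadj by (auto simp: D_refl_mult)
          then have "len (inv v \<otimes> c) \<le> len (inv (r k \<otimes> v) \<otimes> c)"
            using min kI v by simp
          moreover have "inv (r k \<otimes> v) \<otimes> c = (inv v \<otimes> r k \<otimes> v) \<otimes> (inv v \<otimes> c)"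
            using kI v c refl by (simp add: grp refl_inv)
          moreover have "D c (r k) = (D v (r k) \<noteq> D (inv v \<otimes> c) (inv v \<otimes> r k \<otimes> v))"
            using D_mult[of v "inv v \<otimes> c" "r k"] v c kI by simp
          then have "D (inv v \<otimes> c) (inv v \<otimes> r k \<otimes> v)"
            using ne kI by auto
          then have "len ((inv v \<otimes> r k \<otimes> v) \<otimes> (inv v \<otimes> c)) < len (inv v \<otimes> c)"
            using v c kI by (intro len_less) auto
          ultimately show False by simp
        qed
        then show ?thesis using kI kj by (simp add: neg_def)
      qed
      then have "card (neg v) \<le> card (neg c - {j})"
        using fin by (intro card_mono) auto
      also have "\<dots> < card (neg c)"
        using fin j by (intro psubset_card_mono) (auto simp: neg_def)
      finally show False using c(2)[OF v(1)] by simp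
    qed
    then show ?thesis using c by blast
  qed
  then obtain c where c: "c \<in> carrier G" "\<And>i. i \<in> I \<Longrightarrow> D c (r i) \<noteq> e i"
    by blast

  \<comment> \<open>A new descent \<open>j\<close> puts the chamber on the forbidden side of
    \<open>r j\<close>, hence on the permitted sides of the walls of adjacent indices; the remaining
    walls commute with \<open>r j\<close> and keep their sides.\<close>
  have pingpong: "\<forall>i\<in>I. D (\<alpha> w \<otimes> c) (r i) = e i \<longleftrightarrow> D w (s i)" if "w \<in> carrier G" for w
    using that
  proof (induction w rule: descent_induct)
    case one
    then show ?case using c by simp
  next
    case (descent j w)
    have aw: "\<alpha> w \<otimes> c \<in> carrier G" "\<alpha> (s j \<otimes> w) \<otimes> c = r j \<otimes> (\<alpha> w \<otimes> c)"
      using descent.hyps c by (simp_all add: r_def m_assoc)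
    have "\<not> D w (s j)"
      using descent.hyps by (simp add: D_s_mult)
    then have j: "D (r j \<otimes> (\<alpha> w \<otimes> c)) (r j) = e j"
      using descent.IH descent.hyps refl aw by (auto simp: D_refl_mult)
    show ?case
    proof
      fix i assume i: "i \<in> I"
      consider "i = j" | "adj i j" | "i \<noteq> j" "\<not> adj i j" by blast
      then show "D (\<alpha> (s j \<otimes> w) \<otimes> c) (r i) = e i \<longleftrightarrow> D (s j \<otimes> w) (s i)"
      proof cases
        case 1
        then show ?thesis using j aw descent.hyps by simp
      next
        case 2
        then have "\<not> D (s j \<otimes> w) (s i)"
          using descents_commute[of "s j \<otimes> w" i j] descent.hyps i by auto
        moreover have "D (r j \<otimes> (\<alpha> w \<otimes> c)) (r i) \<noteq> e i"
          using facing[OF i _ 2, of "r j \<otimes> (\<alpha> w \<otimes> c)"] j aw descent.hyps by auto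
        ultimately show ?thesis using aw by simp
      next
        case 3
        have "D (s j \<otimes> w) (s i) = D w (s i)"
          using 3 i descent.hyps by (auto simp: D_s_mult s_comm[of i j] m_assoc)
        moreover have "D (r j \<otimes> (\<alpha> w \<otimes> c)) (r i) = D (\<alpha> w \<otimes> c) (r i)"
          using 3 i descent.hyps comm[of j i] r_eq refl aw by (auto simp: D_refl_mult)
        ultimately show ?thesis using descent.IH i aw by simp
      qed
    qed
  qed

  \<comment> \<open>Surjectivity writes the neighbour \<open>c \<otimes> s i\<close> as
    \<open>\<alpha> w \<otimes> c\<close>. A descent \<open>j\<close> of \<open>w\<close> yields a
    wall between this chamber and \<open>c\<close>, and there is only one such wall.\<close>
  have "\<alpha> (s i) = c \<otimes> s i \<otimes> inv c" if i: "i \<in> I" for i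
  proof -
    have "c \<otimes> s i \<otimes> inv c \<in> \<alpha> ` carrier G"
      using bij i c by (simp add: bij_betw_def)
    then obtain w where w: "w \<in> carrier G" "\<alpha> w = c \<otimes> s i \<otimes> inv c"
      by (metis imageE)
    have "par (\<alpha> w) i"
      using w par_conj[of c "s i" i] i c by simp
    then have "w \<noteq> \<one>"
      by auto
    then obtain j where j: "j \<in> I" "D w (s j)"
      using descent_ex w by blast
    then have "D (c \<otimes> s i) (r j) = e j"
      using pingpong[OF w(1)] w i c by (simp add: m_assoc)
    then have "D (s i) (inv c \<otimes> r j \<otimes> c)"
      using c(2)[OF j(1)] D_mult[of c "s i" "r j"] c(1) i j by auto
    then have rj: "r j = c \<otimes> s i \<otimes> inv c"
      using i j c by (simp add: conj_eq_iff)
    then have "j = i"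
      using par[OF j(1), of i] par_conj[of c "s i" i] i c by (simp add: r_def)
    then show ?thesis using rj by (simp add: r_def)
  qed
  then show ?thesis using c by blast
qed

subsection \<open>Automorphisms and their action on generators\<close>

lemma hom_eqI:
  assumes "f \<in> hom G G" "h \<in> hom G G" "\<And>i. i \<in> I \<Longrightarrow> f (s i) = h (s i)" "w \<in> carrier G"
  shows "f w = h w"
  using assms(4)
proof (induction w rule: left_induct)
  case one
  then show ?case using hom_one[OF _ is_group is_group] assms(1,2) by metis
next
  case (mult i w)
  then show ?case using assms(1-3) by (simp add: hom_mult)
qed

lemma hom_comp_id:
  assumes "f \<in> hom G G" "h \<in> hom G G" "\<And>i. i \<in> I \<Longrightarrow> f (h (s i)) = s i" "w \<in> carrier G"
  shows "f (h w) = w"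
  using assms(4)
proof (induction w rule: left_induct)
  case one
  then show ?case by (simp only: hom_one[OF assms(1) is_group is_group] hom_one[OF assms(2) is_group is_group])
next
  case (mult i w)
  then show ?case
    using assms(3)[of i] hom_in_carrier[OF assms(2)] by (simp add: hom_mult[OF assms(1)] hom_mult[OF assms(2)])
qed

abbreviation Aut :: "(nat word set \<Rightarrow> nat word set) monoid"
  where "Aut \<equiv> AutoGroup G"

lemma carrier_Aut: "carrier Aut = auto G"
  by (simp add: AutoGroup_def)

lemma Aut_hom: "f \<in> carrier Aut \<Longrightarrow> f \<in> hom G G"
  by (simp add: carrier_Aut auto_def)

lemma Aut_bij: "f \<in> carrier Aut \<Longrightarrow> bij_betw f (carrier G) (carrier G)"
  by (simp add: carrier_Aut auto_def Bij_def)

lemma Aut_closed: "f \<in> carrier Aut \<Longrightarrow> w \<in> carrier G \<Longrightarrow> f w \<in> carrier G"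
  by (rule hom_in_carrier[OF Aut_hom])

lemma Aut_mult:
  "f \<in> carrier Aut \<Longrightarrow> u \<in> carrier G \<Longrightarrow> v \<in> carrier G \<Longrightarrow> f (u \<otimes> v) = f u \<otimes> f v"
  by (rule hom_mult[OF Aut_hom])

lemma Aut_G_one: "f \<in> carrier Aut \<Longrightarrow> f \<one> = \<one>"
  using hom_one[OF Aut_hom is_group is_group] .

lemma mult_Aut:
  "f \<in> carrier Aut \<Longrightarrow> h \<in> carrier Aut \<Longrightarrow> w \<in> carrier G \<Longrightarrow> (f \<otimes>\<^bsub>Aut\<^esub> h) w = f (h w)"
  by (simp add: AutoGroup_def BijGroup_def auto_def compose_def)

lemma one_Aut: "w \<in> carrier G \<Longrightarrow> \<one>\<^bsub>Aut\<^esub> w = w"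
  by (simp add: AutoGroup_def BijGroup_def)

lemma Aut_ext:
  assumes "f \<in> carrier Aut" "h \<in> carrier Aut" "\<And>w. w \<in> carrier G \<Longrightarrow> f w = h w"
  shows "f = h"
  using assms by (intro extensionalityI[of f "carrier G"]) (auto simp: carrier_Aut auto_def Bij_def)

lemma Aut_eqI:
  assumes "f \<in> carrier Aut" "h \<in> carrier Aut" "\<And>i. i \<in> I \<Longrightarrow> f (s i) = h (s i)"
  shows "f = h"
  by (rule Aut_ext[OF assms(1,2)], rule hom_eqI[OF Aut_hom Aut_hom, OF assms])

lemma s_Aut_sq: "f \<in> carrier Aut \<Longrightarrow> i \<in> I \<Longrightarrow> f (s i) \<otimes> f (s i) = \<one>"
  by (simp only: Aut_mult[symmetric] s_closed s_sq Aut_G_one)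

text \<open>The universal property of the presentation: let \<open>s i\<close> act on the group as
  left multiplication by \<open>y i\<close>, and read off the image of \<one>.\<close>

definition endo :: "(nat \<Rightarrow> nat word set) \<Rightarrow> nat word set \<Rightarrow> nat word set"
  where "endo y = (\<lambda>w\<in>carrier G. act (\<lambda>i x. if x \<in> carrier G then y i \<otimes> x else x) w \<one>)"

definition gen_images :: "(nat \<Rightarrow> nat word set) \<Rightarrow> bool"
  where "gen_images y \<longleftrightarrow> (\<forall>i\<in>I. y i \<in> carrier G \<and> y i \<otimes> y i = \<one>) \<and>
    (\<forall>i\<in>I. \<forall>j\<in>I. i \<noteq> j \<longrightarrow> \<not> adj i j \<longrightarrow> y i \<otimes> y j = y j \<otimes> y i)"

lemma endo:
  assumes y: "gen_images y"
  shows endo_hom: "endo y \<in> hom G G" and endo_s: "i \<in> I \<Longrightarrow> endo y (s i) = y i"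
proof -
  let ?f = "\<lambda>i x. if x \<in> carrier G then y i \<otimes> x else x"
  have f: "twin_action ?f"
    using y unfolding twin_action_def gen_images_def by (auto simp flip: m_assoc)
  have left_mult: "\<exists>g\<in>carrier G. \<forall>x\<in>carrier G. act ?f w x = g \<otimes> x" if "w \<in> carrier G" for w
    using that
  proof (induction w rule: left_induct)
    case one
    show ?case by (intro bexI[of _ \<one>]) (simp_all add: act_one[OF f])
  next
    case (mult i w)
    then obtain g where "g \<in> carrier G" "\<And>x. x \<in> carrier G \<Longrightarrow> act ?f w x = g \<otimes> x" by blast
    moreover have "y i \<in> carrier G" using y mult by (simp add: gen_images_def)
    ultimately show ?case
      using mult.hyps by (intro bexI[of _ "y i \<otimes> g"]) (auto simp: act_mult[OF f] act_s[OF f] m_assoc)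
  qed
  show "endo y \<in> hom G G"
  proof (rule homI)
    fix u v assume uv: "u \<in> carrier G" "v \<in> carrier G"
    obtain g where "g \<in> carrier G" "\<And>x. x \<in> carrier G \<Longrightarrow> act ?f u x = g \<otimes> x"
      using left_mult[OF uv(1)] by blast
    moreover obtain h where "h \<in> carrier G" "\<And>x. x \<in> carrier G \<Longrightarrow> act ?f v x = h \<otimes> x"
      using left_mult[OF uv(2)] by blast
    ultimately show "endo y (u \<otimes> v) = endo y u \<otimes> endo y v"
      using uv by (simp add: endo_def act_mult[OF f])
  next
    fix u assume u: "u \<in> carrier G"
    then show "endo y u \<in> carrier G"
      using left_mult[OF u] by (auto simp: endo_def)
  qed
  show "i \<in> I \<Longrightarrow> endo y (s i) = y i"
    using y by (simp add: endo_def act_s[OF f] gen_images_def)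
qed

lemma endo_Aut:
  assumes y: "gen_images y" "gen_images z"
    and inv: "\<And>i. i \<in> I \<Longrightarrow> endo y (z i) = s i" "\<And>i. i \<in> I \<Longrightarrow> endo z (y i) = s i"
  shows "endo y \<in> carrier Aut"
proof -
  have "endo y (endo z w) = w" "endo z (endo y w) = w" if "w \<in> carrier G" for w
    using that inv y by (simp_all add: hom_comp_id[OF endo_hom endo_hom] endo_s)
  then have "bij_betw (endo y) (carrier G) (carrier G)"
    using endo_hom[OF y(1)] endo_hom[OF y(2)]
    by (intro bij_betwI[where g = "endo z"]) (auto simp: hom_def)
  then show ?thesis
    using endo_hom[OF y(1)] by (simp add: carrier_Aut auto_def Bij_def endo_def)
qed

section \<open>The matrix of an automorphism over Z/2\<close>

lemma par_outside: "w \<in> carrier G \<Longrightarrow> par w a \<Longrightarrow> a \<in> I"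
  by (induction w rule: left_induct) auto

lemma par_hom_cong:
  assumes "f \<in> hom G G" "w \<in> carrier G" "\<And>i. i \<in> I \<Longrightarrow> par (f (s i)) a = par (f (s i)) b"
  shows "par (f w) a = par (f w) b"
  using assms(2)
proof (induction w rule: left_induct)
  case one
  then show ?case using hom_one[OF assms(1) is_group is_group] by simp
next
  case (mult i w)
  then show ?case using assms hom_mult[OF assms(1)] hom_in_carrier[OF assms(1)] by simp
qed

text \<open>Row \<open>a\<close> of the matrix of \<open>f\<close> on the abelianization, as a set of columns.\<close>

definition row :: "(nat word set \<Rightarrow> nat word set) \<Rightarrow> nat \<Rightarrow> nat set"
  where "row f a = {i \<in> I. par (f (s i)) a}"

text \<open>Index 0 lies outside \<open>I\<close>, so every parity at 0 vanishes. An empty row would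
  agree with that of index 0, and \<open>s a\<close> could not be in the image of
  \<open>f\<close>.\<close>

lemma row_nonempty:
  assumes f: "f \<in> carrier Aut" and a: "a \<in> I"
  shows "row f a \<noteq> {}"
proof
  assume "row f a = {}"
  moreover have "\<not> par (f (s i)) 0" if "i \<in> I" for i
    using par_outside[of "f (s i)" 0] that Aut_closed[OF f] by (auto simp: I_def)
  ultimately have "par (f w) a = par (f w) 0" if "w \<in> carrier G" for w
    using par_hom_cong[OF Aut_hom[OF f] that] by (auto simp: row_def)
  moreover obtain w where "w \<in> carrier G" "f w = s a"
    using Aut_bij[OF f] s_closed[OF a] unfolding bij_betw_def by (metis imageE)
  ultimately have "par (s a) a = par (s a) 0" by metis
  then have "a = 0" using a by simp
  then show False using a by (simp add: I_def)
qed

lemma row_inj: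
  assumes f: "f \<in> carrier Aut" and ab: "a \<in> I" "b \<in> I" "row f a = row f b"
  shows "a = b"
proof -
  have "par (f w) a = par (f w) b" if "w \<in> carrier G" for w
    using ab(3) by (intro par_hom_cong[OF Aut_hom[OF f] that]) (auto simp: row_def)
  moreover obtain w where "w \<in> carrier G" "f w = s a"
    using Aut_bij[OF f] s_closed[OF ab(1)] unfolding bij_betw_def by (metis imageE)
  ultimately have "par (s a) a = par (s a) b" by metis
  then show ?thesis using ab by simp
qed

text \<open>If \<open>i\<close> and \<open>j\<close> were not adjacent, \<open>s i \<otimes> s j\<close> would have square \<open>\<one>\<close>, and its image would be
  odd in both \<open>a\<close> and \<open>b\<close>.\<close>

lemma row_adj:
  assumes f: "f \<in> carrier Aut" and ab: "adj a b" and ij: "i \<in> row f a" "j \<in> row f b"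
  shows "adj i j"
proof (rule ccontr)
  assume nadj: "\<not> adj i j"
  have I: "i \<in> I" "j \<in> I" using ij by (auto simp: row_def)
  have p: "par (f (s i)) a" "\<not> par (f (s i)) b" "par (f (s j)) b" "\<not> par (f (s j)) a"
    using ij involution_par[OF _ s_Aut_sq[OF f] ab] Aut_closed[OF f] by (auto simp: row_def)
  have "(s i \<otimes> s j) \<otimes> (s i \<otimes> s j) = \<one>"
    using I nadj by (simp add: m_assoc s_comm_left[of i j])
  then have "f (s i \<otimes> s j) \<otimes> f (s i \<otimes> s j) = \<one>"
    using f I by (metis Aut_G_one Aut_mult m_closed s_closed)
  then have "\<not> (par (f (s i \<otimes> s j)) a \<and> par (f (s i \<otimes> s j)) b)"
    using I Aut_closed[OF f] by (intro involution_par[OF _ _ ab]) auto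
  then show False
    using p I Aut_closed[OF f] by (simp add: Aut_mult[OF f])
qed

section \<open>Splitting over the inner automorphisms\<close>

lemma inner_aut_Aut: "g \<in> carrier G \<Longrightarrow> inner_aut G g \<in> carrier Aut"
  unfolding carrier_Aut auto_def Bij_def inner_aut_def
  by (auto intro!: homI bij_betwI[where g = "\<lambda>x. inv g \<otimes> x \<otimes> g"] simp: m_assoc)

lemma inner_aut_apply: "w \<in> carrier G \<Longrightarrow> inner_aut G g w = g \<otimes> w \<otimes> inv g"
  by (simp add: inner_aut_def)

text \<open>Each \<open>f\<close> composed with a suitable \<open>\<rho> k\<close> has trivial
  matrix and so is inner. If conjugation by \<open>g\<close> after \<open>\<rho> k\<close> is the
  identity, then \<open>\<rho> k\<close> has trivial matrix because conjugation keeps parities;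
  hence \<open>k\<close> is trivial and \<open>g\<close> is central.\<close>

lemma split_of_complement:
  assumes n: "n \<ge> 3" and K: "group K" and \<rho>: "\<rho> \<in> hom K Aut"
    and surj: "\<And>f. f \<in> carrier Aut \<Longrightarrow>
      \<exists>k\<in>carrier K. \<forall>i\<in>I. \<forall>a. par (f (\<rho> k (s i))) a \<longleftrightarrow> a = i"
    and inj: "\<And>k. k \<in> carrier K \<Longrightarrow> \<forall>i\<in>I. \<forall>a. par (\<rho> k (s i)) a \<longleftrightarrow> a = i \<Longrightarrow> k = \<one>\<^bsub>K\<^esub>"
  shows "Aut_iso_semidirect G K"
proof -
  interpret A: group Aut by (rule AutoGroup)
  interpret K: group K by (rule K)
  interpret \<rho>: group_hom K Aut \<rho> by (unfold_locales) (rule \<rho>)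
  let ?S = "semidirect_product G K \<rho>"
  interpret S: group ?S by (rule group_semidirect_product[OF is_group K \<rho>])
  define \<Psi> where "\<Psi> = (\<lambda>(g, k). inner_aut G g \<otimes>\<^bsub>Aut\<^esub> \<rho> k)"
  have carr: "carrier ?S = carrier G \<times> carrier K" and one: "\<one>\<^bsub>?S\<^esub> = (\<one>, \<one>\<^bsub>K\<^esub>)"
    by (simp_all add: semidirect_product_def)
  have \<Psi>: "\<Psi> (g, k) w = g \<otimes> \<rho> k w \<otimes> inv g"
    if "g \<in> carrier G" "k \<in> carrier K" "w \<in> carrier G" for g k w
  proof -
    have "\<Psi> (g, k) w = inner_aut G g (\<rho> k w)"
      unfolding \<Psi>_def prod.case using that by (intro mult_Aut inner_aut_Aut \<rho>.hom_closed)
    also have "\<dots> = g \<otimes> \<rho> k w \<otimes> inv g"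
      using that by (intro inner_aut_apply Aut_closed[of "\<rho> k"] \<rho>.hom_closed)
    finally show ?thesis .
  qed
  have \<Psi>_closed: "\<Psi> (g, k) \<in> carrier Aut" if "g \<in> carrier G" "k \<in> carrier K" for g k
    using that by (simp add: \<Psi>_def inner_aut_Aut)
  have hom: "\<Psi> \<in> hom ?S Aut"
  proof (rule homI)
    fix x y assume "x \<in> carrier ?S" "y \<in> carrier ?S"
    then obtain g k h l where xy: "x = (g, k)" "y = (h, l)"
      and c: "g \<in> carrier G" "k \<in> carrier K" "h \<in> carrier G" "l \<in> carrier K"
      by (auto simp: carr)
    have \<rho>h: "\<rho> k h \<in> carrier G"
      using c Aut_closed by simp
    have \<rho>k: "\<rho> k \<in> carrier Aut"
      using c by simp
    have "\<rho> k (inv h) \<otimes> \<rho> k h = \<one>"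
      using Aut_mult[OF \<rho>k, of "inv h" h] Aut_G_one[OF \<rho>k] c by simp
    then have "inv (\<rho> k h) = \<rho> k (inv h)"
      using c \<rho>h Aut_closed[OF \<rho>k] by (intro inv_equality) simp_all
    then have "\<Psi> (g \<otimes> \<rho> k h, k \<otimes>\<^bsub>K\<^esub> l) = \<Psi> (g, k) \<otimes>\<^bsub>Aut\<^esub> \<Psi> (h, l)"
      using c \<rho>h Aut_closed[of "\<rho> l"] by (intro Aut_ext)
        (simp_all add: \<Psi>_closed \<Psi> mult_Aut Aut_closed[OF \<rho>k] Aut_mult[OF \<rho>k] grp)
    then show "\<Psi> (x \<otimes>\<^bsub>?S\<^esub> y) = \<Psi> x \<otimes>\<^bsub>Aut\<^esub> \<Psi> y"
      by (simp add: xy semidirect_product_def)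
  qed (auto simp: carr \<Psi>_closed)
  then interpret \<Psi>: group_hom ?S Aut \<Psi> by (unfold_locales)
  have "x = \<one>\<^bsub>?S\<^esub>" if x: "x \<in> carrier ?S" "\<Psi> x = \<one>\<^bsub>Aut\<^esub>" for x
  proof -
    obtain g k where gk: "x = (g, k)" "g \<in> carrier G" "k \<in> carrier K"
      using x by (auto simp: carr)
    have eq: "g \<otimes> \<rho> k (s i) \<otimes> inv g = s i" if "i \<in> I" for i
      using x(2) gk that \<Psi>[of g k "s i"] one_Aut by simp
    have "par (\<rho> k (s i)) a \<longleftrightarrow> a = i" if "i \<in> I" for i a
      using par_conj[of g "\<rho> k (s i)" a] eq[OF that] gk that Aut_closed[of "\<rho> k"] by auto
    then have k: "k = \<one>\<^bsub>K\<^esub>"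
      using inj gk by blast
    have "g = \<one>"
    proof (rule central_eq_one[OF n gk(2)])
      fix i assume i: "i \<in> I"
      have "g \<otimes> s i \<otimes> inv g \<otimes> g = s i \<otimes> g"
        using eq[OF i] i k by (simp add: one_Aut)
      then show "g \<otimes> s i = s i \<otimes> g"
        using gk i by (simp add: m_assoc)
    qed
    then show ?thesis using k gk one by simp
  qed
  then have "inj_on \<Psi> (carrier ?S)"
    using \<Psi>.inj_on_one_iff by blast
  moreover have "\<Psi> ` carrier ?S = carrier Aut"
  proof (intro equalityI subsetI)
    fix f assume f: "f \<in> carrier Aut"
    then obtain k where k: "k \<in> carrier K" "\<forall>i\<in>I. \<forall>a. par (f (\<rho> k (s i))) a \<longleftrightarrow> a = i"
      using surj by blast
    define h where "h = f \<otimes>\<^bsub>Aut\<^esub> \<rho> k"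
    have h: "h \<in> carrier Aut" "\<And>i a. i \<in> I \<Longrightarrow> par (h (s i)) a \<longleftrightarrow> a = i"
      using f k by (simp_all add: h_def mult_Aut)
    then obtain c where c: "c \<in> carrier G" "\<forall>i\<in>I. h (s i) = c \<otimes> s i \<otimes> inv c"
      using inner_of_par[OF Aut_hom[OF h(1)] Aut_bij[OF h(1)]] by blast
    then have "h = inner_aut G c"
      using h by (intro Aut_eqI) (simp_all add: inner_aut_Aut inner_aut_apply)
    then have "f = \<Psi> (c, inv\<^bsub>K\<^esub> k)"
      using f k c by (simp add: \<Psi>_def h_def A.inv_solve_right' flip: \<open>h = inner_aut G c\<close>)
        (simp add: A.m_assoc flip: \<rho>.hom_mult)
    then show "f \<in> \<Psi> ` carrier ?S"
      using c k by (auto simp: carr)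
  qed (auto simp: carr \<Psi>_closed)
  ultimately have "\<Psi> \<in> iso ?S Aut"
    using hom by (simp add: iso_def bij_betw_def)
  moreover have "\<Psi> (g, \<one>\<^bsub>K\<^esub>) = inner_aut G g" if "g \<in> carrier G" for g
    using that by (simp add: \<Psi>_def inner_aut_Aut)
  ultimately show ?thesis
    unfolding Aut_iso_semidirect_def using \<rho> by blast
qed

lemma row_mult:
  assumes "f \<in> carrier Aut" "h \<in> carrier Aut"
  shows "i \<in> row (f \<otimes>\<^bsub>Aut\<^esub> h) a \<longleftrightarrow> i \<in> I \<and> par (f (h (s i))) a"
  using assms by (auto simp: row_def mult_Aut)

lemma row_iff: "i \<in> I \<Longrightarrow> par (f (s i)) a \<longleftrightarrow> i \<in> row f a"
  by (simp add: row_def)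

lemma row_subset: "row f a \<subseteq> I"
  by (auto simp: row_def)

lemma trivial_rows_iff:
  assumes f: "f \<in> carrier Aut"
  shows "(\<forall>i\<in>I. \<forall>a. par (f (s i)) a \<longleftrightarrow> a = i) \<longleftrightarrow> (\<forall>a\<in>I. row f a = {a})"
proof
  assume "\<forall>i\<in>I. \<forall>a. par (f (s i)) a \<longleftrightarrow> a = i"
  then show "\<forall>a\<in>I. row f a = {a}"
    by (auto simp: row_def)
next
  assume *: "\<forall>a\<in>I. row f a = {a}"
  show "\<forall>i\<in>I. \<forall>a. par (f (s i)) a \<longleftrightarrow> a = i"
  proof (intro ballI allI)
    fix i a assume i: "i \<in> I"
    show "par (f (s i)) a \<longleftrightarrow> a = i"
    proof (cases "a \<in> I")
      case True
      then show ?thesis using * i by (auto simp: row_iff)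
    next
      case False
      then show ?thesis using i par_outside[of "f (s i)" a] Aut_closed[OF f] by auto
    qed
  qed
qed

lemma split_of_rows:
  assumes n: "n \<ge> 3" and K: "group K" and \<rho>: "\<rho> \<in> hom K Aut"
    and surj: "\<And>f. f \<in> carrier Aut \<Longrightarrow> \<exists>k\<in>carrier K. \<forall>a\<in>I. row (f \<otimes>\<^bsub>Aut\<^esub> \<rho> k) a = {a}"
    and inj: "\<And>k. k \<in> carrier K \<Longrightarrow> \<forall>a\<in>I. row (\<rho> k) a = {a} \<Longrightarrow> k = \<one>\<^bsub>K\<^esub>"
  shows "Aut_iso_semidirect G K"
proof (rule split_of_complement[OF n K \<rho>])
  interpret A: group Aut by (rule AutoGroup)
  fix f assume f: "f \<in> carrier Aut"
  then obtain k where k: "k \<in> carrier K" "\<forall>a\<in>I. row (f \<otimes>\<^bsub>Aut\<^esub> \<rho> k) a = {a}"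
    using surj by blast
  have \<rho>k: "\<rho> k \<in> carrier Aut" using hom_in_carrier[OF \<rho> k(1)] .
  have "\<forall>i\<in>I. \<forall>a. par ((f \<otimes>\<^bsub>Aut\<^esub> \<rho> k) (s i)) a \<longleftrightarrow> a = i"
    using trivial_rows_iff[of "f \<otimes>\<^bsub>Aut\<^esub> \<rho> k"] k(2) f \<rho>k by blast
  then show "\<exists>k\<in>carrier K. \<forall>i\<in>I. \<forall>a. par (f (\<rho> k (s i))) a \<longleftrightarrow> a = i"
    using k(1) by (auto simp: mult_Aut[OF f \<rho>k])
next
  fix k assume "k \<in> carrier K" "\<forall>i\<in>I. \<forall>a. par (\<rho> k (s i)) a \<longleftrightarrow> a = i"
  then show "k = \<one>\<^bsub>K\<^esub>"
    using inj trivial_rows_iff[OF hom_in_carrier[OF \<rho>]] by blast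
qed

lemma endo_involution:
  assumes "gen_images y" "\<And>i. i \<in> I \<Longrightarrow> endo y (y i) = s i"
  shows "endo y \<in> carrier Aut" "endo y \<otimes>\<^bsub>Aut\<^esub> endo y = \<one>\<^bsub>Aut\<^esub>"
proof -
  interpret A: group Aut by (rule AutoGroup)
  show y: "endo y \<in> carrier Aut"
    using assms by (intro endo_Aut[of y y])
  show "endo y \<otimes>\<^bsub>Aut\<^esub> endo y = \<one>\<^bsub>Aut\<^esub>"
    using y assms by (intro Aut_eqI) (simp_all add: mult_Aut[OF y y] one_Aut endo_s)
qed

section \<open>The flip, and the case n = 3\<close>

definition flip :: "nat word set \<Rightarrow> nat word set"
  where "flip = endo (\<lambda>i. s (n - i))"

lemma flip_I [simp]: "i \<in> I \<Longrightarrow> n - i \<in> I"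
  by (auto simp: I_def)

lemma flip_flip [simp]: "i \<in> I \<Longrightarrow> n - (n - i) = i"
  by (auto simp: I_def)

lemma flip_images: "gen_images (\<lambda>i. s (n - i))"
proof -
  have "s (n - i) \<otimes> s (n - j) = s (n - j) \<otimes> s (n - i)" if "i \<in> I" "j \<in> I" "\<not> adj i j" for i j
  proof (rule s_comm)
    show "\<not> adj (n - i) (n - j)"
      using that by (auto simp: I_def)
  qed (use that in simp_all)
  then show ?thesis
    unfolding gen_images_def by simp
qed

lemma flip_s [simp]: "i \<in> I \<Longrightarrow> flip (s i) = s (n - i)"
  by (simp add: flip_def endo_s[OF flip_images])

lemma flip_Aut: "flip \<in> carrier Aut" and flip_sq: "flip \<otimes>\<^bsub>Aut\<^esub> flip = \<one>\<^bsub>Aut\<^esub>"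
  using endo_involution[OF flip_images] flip_s by (simp_all add: flip_def)

lemma row_flip: "f \<in> carrier Aut \<Longrightarrow> i \<in> row (f \<otimes>\<^bsub>Aut\<^esub> flip) a \<longleftrightarrow> i \<in> I \<and> n - i \<in> row f a"
  by (auto simp: row_mult flip_Aut row_iff)

text \<open>On the indices 1 and 2 adjacency means being different, so rows 1 and 2 are the two
  singletons in one of the two orders.\<close>

lemma Aut_split_3:
  assumes n: "n = 3"
  shows "Aut_iso_semidirect G (integer_mod_group 2)"
proof -
  interpret A: group Aut by (rule AutoGroup)
  have I: "I = {1, 2}" unfolding I_def using n by auto
  have nm: "n - 1 = 2" "n - 2 = 1" using n by simp_all
  define \<rho> where "\<rho> e = (if e = 0 then \<one>\<^bsub>Aut\<^esub> else flip)" for e :: int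
  have carr: "carrier (integer_mod_group 2) = {0, 1}"
    by (auto simp: carrier_integer_mod_group)
  show ?thesis
  proof (rule split_of_rows[of _ \<rho>])
    show "\<rho> \<in> hom (integer_mod_group 2) Aut"
      by (rule homI) (auto simp: carr \<rho>_def flip_Aut flip_sq)
  next
    fix f assume f: "f \<in> carrier Aut"
    obtain i j where ij: "i \<in> row f 1" "j \<in> row f 2"
      using row_nonempty[OF f, of 1] row_nonempty[OF f, of 2] I by blast
    have rows: "adj x y" if "x \<in> row f 1" "y \<in> row f 2" for x y
      using row_adj[OF f, of 1 2] that by simp
    have sub: "x = 1 \<or> x = 2" if "x \<in> row f a" for x a
      using that row_subset I by blast
    from sub[OF ij(1)] show "\<exists>k\<in>carrier (integer_mod_group 2). \<forall>a\<in>I. row (f \<otimes>\<^bsub>Aut\<^esub> \<rho> k) a = {a}"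
    proof
      assume i: "i = 1"
      have j: "j = 2" using rows[OF ij] sub[OF ij(2)] i by auto
      have "x = 1" if "x \<in> row f 1" for x using rows[OF that ij(2)] sub[OF that] j by auto
      moreover have "x = 2" if "x \<in> row f 2" for x using rows[OF ij(1) that] sub[OF that] i by auto
      ultimately have "row f 1 = {1}" "row f 2 = {2}"
        using ij i j by blast+
      then show ?thesis
        using f by (intro bexI[of _ 0]) (auto simp: I carr \<rho>_def)
    next
      assume i: "i = 2"
      have j: "j = 1" using rows[OF ij] sub[OF ij(2)] i by auto
      have "x = 2" if "x \<in> row f 1" for x using rows[OF that ij(2)] sub[OF that] j by auto
      moreover have "x = 1" if "x \<in> row f 2" for x using rows[OF ij(1) that] sub[OF that] i by auto
      ultimately have "row f 1 = {2}" "row f 2 = {1}"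
        using ij i j by blast+
      then show ?thesis
        using f nm by (intro bexI[of _ 1]) (auto simp: I carr \<rho>_def row_flip)
    qed
  next
    fix k :: int assume k: "k \<in> carrier (integer_mod_group 2)" "\<forall>a\<in>I. row (\<rho> k) a = {a}"
    have "1 \<in> row flip 2" using nm by (simp add: row_def I)
    then show "k = \<one>\<^bsub>integer_mod_group 2\<^esub>"
      using k by (auto simp: carr \<rho>_def I)
  qed (use n in simp_all)
qed

text \<open>\<open>s 1\<close> and \<open>s 3\<close> generate a Klein four-group, whose three involutions are permuted.\<close>

lemma Aut_split_4:
  assumes n: "n = 4"
  shows "Aut_iso_semidirect G (sym_group 3)"
proof -
  interpret A: group Aut by (rule AutoGroup)
  have I: "I = {1, 2, 3}" unfolding I_def using n by auto
  have sc: "s 1 \<in> carrier G" "s 2 \<in> carrier G" "s 3 \<in> carrier G"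
    and ss: "s 1 \<otimes> s 1 = \<one>" "s 2 \<otimes> s 2 = \<one>" "s 3 \<otimes> s 3 = \<one>"
    using I by simp_all
  have s31: "s 3 \<otimes> s 1 = s 1 \<otimes> s 3"
    using I by (intro s_comm) auto
  \<comment> \<open>The involutions are indexed by 1, 2, 3 so that \<open>sym_group 3\<close> acts
    on the indices directly. Any index other than 1 and 2 stands for the product.\<close>
  define v where "v k = (if k = 1 then s 1 else if k = 2 then s 3 else s 1 \<otimes> s 3)" for k :: nat
  have v: "v 1 = s 1" "v 2 = s 3" "v 3 = s 1 \<otimes> s 3" by (simp_all add: v_def)
  have vc [simp]: "v k \<in> carrier G" for k using sc by (simp add: v_def)
  have s311: "s 3 \<otimes> (s 1 \<otimes> x) = s 1 \<otimes> (s 3 \<otimes> x)" "s 1 \<otimes> (s 1 \<otimes> x) = x" "s 3 \<otimes> (s 3 \<otimes> x) = x"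
    if "x \<in> carrier G" for x
    using that sc ss s31 by (simp_all flip: m_assoc)
  have vv: "v k \<otimes> v k = \<one>" "v k \<otimes> v l = v l \<otimes> v k" for k l
    using sc ss s31 s311 by (simp_all add: v_def m_assoc)
  have v_mult: "v a \<otimes> v b = v c" if "{a, b, c} = {1, 2, 3}" for a b c
  proof -
    have "card {a, b, c} = 3" using that by simp
    then have "a \<noteq> b" "b \<noteq> c" "a \<noteq> c" by (auto simp: card_insert_if split: if_splits)
    moreover have "a \<in> {1, 2, 3}" "b \<in> {1, 2, 3}" "c \<in> {1, 2, 3}" using that by auto
    ultimately show ?thesis
      using sc ss s31 s311 by (auto simp: v_def m_assoc)
  qed
  \<comment> \<open>No relation ties \<open>s 2\<close> to \<open>s 1\<close> or \<open>s 3\<close>,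
    so every permutation of the three involutions extends by fixing \<open>s 2\<close>.\<close>
  define y where "y p i = (if i = 1 then v (p 1) else if i = 3 then v (p 2) else s i)"
    for p :: "nat \<Rightarrow> nat" and i
  have y: "gen_images (y p)" for p
  proof -
    have "y p i \<in> carrier G \<and> y p i \<otimes> y p i = \<one>" if "i \<in> I" for i
      using that by (simp add: y_def vv(1))
    moreover have "y p i \<otimes> y p j = y p j \<otimes> y p i" if "i \<in> I" "j \<in> I" "i \<noteq> j" "\<not> adj i j" for i j
      using that I by (auto simp: y_def vv(2))
    ultimately show ?thesis unfolding gen_images_def by blast
  qed
  have yv: "endo (y p) (v k) = v (p k)" if p: "p permutes {1..3}" and k: "k \<in> {1..3}" for p k
  proof -
    have e: "endo (y p) (s 1) = v (p 1)" "endo (y p) (s 3) = v (p 2)"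
      using endo_s[OF y, of 1 p] endo_s[OF y, of 3 p] I by (simp_all add: y_def)
    have "{1..3} = {1, 2, 3::nat}" by auto
    with permutes_image[OF p] have "p ` {1, 2, 3} = {1, 2, 3}" by (simp only:)
    then have "{p 1, p 2, p 3} = {1, 2, 3}" by (simp only: image_insert image_empty)
    then have "endo (y p) (v 3) = v (p 3)"
      using hom_mult[OF endo_hom[OF y], of "s 1" "s 3" p] sc e v_mult by (simp add: v(3))
    moreover have "k = 1 \<or> k = 2 \<or> k = 3" using k by auto
    ultimately show ?thesis
      using e v by auto
  qed
  have comp: "endo (y p) (endo (y q) (s i)) = y (p \<circ> q) i"
    if "p permutes {1..3}" "q permutes {1..3}" "i \<in> I" for p q i
  proof -
    have "q 1 \<in> {1..3}" "q 2 \<in> {1..3}"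
      using permutes_in_image[OF that(2)] by auto
    moreover have "endo (y p) (s 2) = s 2" using endo_s[OF y, of 2 p] I by (simp add: y_def)
    moreover have "i = 1 \<or> i = 2 \<or> i = 3" using that(3) I by auto
    ultimately show ?thesis
      using that yv[OF that(1)] by (auto simp: endo_s[OF y] y_def)
  qed
  have y_id: "y id i = s i" if "i \<in> I" for i
    using that by (auto simp: y_def v_def)
  have Aut: "endo (y p) \<in> carrier Aut" if p: "p permutes {1..3}" for p
  proof (rule endo_Aut[OF y y])
    fix i assume i: "i \<in> I"
    show "endo (y p) (y (inv_into UNIV p) i) = s i" "endo (y (inv_into UNIV p)) (y p i) = s i"
      using comp[OF p permutes_inv[OF p] i] comp[OF permutes_inv[OF p] p i] y_id[OF i] i
        permutes_inv_o[OF p] by (simp_all add: endo_s[OF y])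
  qed
  show ?thesis
  proof (rule split_of_rows)
    show "(\<lambda>p. endo (y p)) \<in> hom (sym_group 3) Aut"
    proof (rule homI)
      fix p q assume "p \<in> carrier (sym_group 3)" "q \<in> carrier (sym_group 3)"
      then have pq: "p permutes {1..3}" "q permutes {1..3}" "p \<circ> q permutes {1..3}"
        by (auto simp: sym_group_def permutes_compose)
      have "endo (y (p \<circ> q)) = endo (y p) \<otimes>\<^bsub>Aut\<^esub> endo (y q)"
        using comp[OF pq(1,2)] Aut pq
        by (intro Aut_eqI) (simp_all add: mult_Aut[OF Aut Aut] endo_s[OF y, of _ "p \<circ> q"])
      then show "endo (y (p \<otimes>\<^bsub>sym_group 3\<^esub> q)) = endo (y p) \<otimes>\<^bsub>Aut\<^esub> endo (y q)"
        by (simp add: sym_group_def)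
    qed (simp add: sym_group_def Aut)
  next
    fix f assume f: "f \<in> carrier Aut"
    have rows: "adj i j" if "i \<in> row f a" "j \<in> row f b" "adj a b" for i j a b
      using row_adj[OF f] that by blast
    have sub: "i = 1 \<or> i = 2 \<or> i = 3" if "i \<in> row f a" for i a
      using that row_subset I by blast
    have "row f 1 \<noteq> {}" "row f 2 \<noteq> {}" "row f 3 \<noteq> {}"
      using I by (simp_all add: row_nonempty[OF f])
    then obtain i1 i2 i3 where i: "i1 \<in> row f 1" "i2 \<in> row f 2" "i3 \<in> row f 3"
      by blast
    have ne: "row f 1 \<noteq> row f 3"
      using row_inj[OF f, of 1 3] I by auto
    \<comment> \<open>In \<open>I\<close> the indices 1 and 3 have 2 as their only neighbour; if row
      2 lacked 2, rows 1 and 3 would both be {2}.\<close>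
    have "2 \<in> row f 2"
    proof (rule ccontr)
      assume "2 \<notin> row f 2"
      then have i2: "i2 = 1 \<or> i2 = 3" using sub[OF i(2)] i(2) by auto
      have "x = 2" if "x \<in> row f 1 \<or> x \<in> row f 3" for x
        using that rows[of x 1 i2 2] rows[of x 3 i2 2] i(2) i2 sub[of x 1] sub[of x 3] by auto
      then have "row f 1 = {2}" "row f 3 = {2}" using i(1,3) by blast+
      then show False using ne by simp
    qed
    then have r13: "x = 1 \<or> x = 3" if "x \<in> row f 1 \<or> x \<in> row f 3" for x
      using that rows[of x 1 2 2] rows[of x 3 2 2] sub[of x 1] sub[of x 3] by auto
    have "x = 2" if "x \<in> row f 2" for x
      using rows[OF i(1) that] r13[of i1] i(1) sub[OF that] by auto
    then have r2: "row f 2 = {2}"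
      using \<open>2 \<in> row f 2\<close> by blast
    define P where "P k a = par (f (v k)) a" for k a
    have fv: "f (v 3) = f (s 1) \<otimes> f (s 3)"
      using Aut_mult[OF f, of "s 1" "s 3"] sc by (simp add: v)
    have P: "P 1 a \<longleftrightarrow> 1 \<in> row f a" "P 2 a \<longleftrightarrow> 3 \<in> row f a"
        "P 3 a \<longleftrightarrow> (1 \<in> row f a) \<noteq> (3 \<in> row f a)" for a
      using Aut_closed[OF f] sc I by (simp_all add: P_def fv row_def) (simp_all add: v_def)
    \<comment> \<open>In coordinates 1 and 3 the images of the three involutions have the three
      nonzero vectors of the plane over Z/2 as parities; \<open>a\<close> and \<open>b\<close>
      select the unit vectors.\<close>
    have "\<exists>a\<in>{1..3}. \<exists>b\<in>{1..3}. a \<noteq> b \<and> P a 1 \<and> \<not> P a 3 \<and> \<not> P b 1 \<and> P b 3 \<and>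
        (\<forall>k\<in>{a, b}. \<not> P k 2)"
    proof -
      have e: "{1..3} = {1, 2, 3::nat}" by auto
      have "\<not> (\<forall>x. (x \<in> row f 1) = (x \<in> row f 3))" using ne by blast
      then obtain x where x: "(x \<in> row f 1) \<noteq> (x \<in> row f 3)" by blast
      then have "x = 1 \<or> x = 3" using r13[of x] by blast
      with x have "(1 \<in> row f 1) \<noteq> (1 \<in> row f 3) \<or> (3 \<in> row f 1) \<noteq> (3 \<in> row f 3)"
        by auto
      moreover have "1 \<in> row f 1 \<or> 3 \<in> row f 1" "1 \<in> row f 3 \<or> 3 \<in> row f 3"
        using i r13[of i1] r13[of i3] by auto
      ultimately show ?thesis
        unfolding e using P r2 by simp argo
    qed
    then obtain a b where ab: "a \<in> {1..3}" "b \<in> {1..3}" "a \<noteq> b" "P a 1" "\<not> P a 3" "\<not> P b 1" "P b 3"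
      "\<not> P a 2" "\<not> P b 2" by blast
    obtain p where p: "p permutes {1..3}" "p 1 = a" "p 2 = b"
      using permutes_123_ex ab by blast
    have "x \<in> row (f \<otimes>\<^bsub>Aut\<^esub> endo (y p)) c \<longleftrightarrow> x = c" if c: "c \<in> I" for c x
    proof (cases "x \<in> I")
      case x: True
      have "x \<in> row (f \<otimes>\<^bsub>Aut\<^esub> endo (y p)) c \<longleftrightarrow> par (f (y p x)) c"
        using x by (simp add: row_mult[OF f Aut[OF p(1)]] endo_s[OF y])
      moreover have "par (f (y p 1)) c \<longleftrightarrow> 1 = c" "par (f (y p 3)) c \<longleftrightarrow> 3 = c"
        using c I ab p unfolding P_def by (auto simp: y_def)
      moreover have "par (f (y p 2)) c \<longleftrightarrow> 2 \<in> row f c"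
        using I by (simp add: y_def row_def)
      moreover have "2 \<in> row f c \<longleftrightarrow> 2 = c"
        using c I r2 r13[of 2] by auto
      ultimately show ?thesis
        using x I by auto
    next
      case False
      then show ?thesis using c row_subset by blast
    qed
    then show "\<exists>p\<in>carrier (sym_group 3). \<forall>a\<in>I. row (f \<otimes>\<^bsub>Aut\<^esub> endo (y p)) a = {a}"
      using p by (intro bexI[of _ p]) (auto simp: sym_group_def)
  next
    fix p assume "p \<in> carrier (sym_group 3)"
    then have p: "p permutes {1..3}" by (simp add: sym_group_def)
    assume "\<forall>a\<in>I. row (endo (y p)) a = {a}"
    then have *: "x \<in> row (endo (y p)) a \<longleftrightarrow> x = a" if "a \<in> I" for x a
      using that by blast
    have par: "par (v k) 1 \<longleftrightarrow> k \<noteq> 2" "par (v k) 3 \<longleftrightarrow> k \<noteq> 1" for k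
      using I sc by (simp_all add: v_def)
    have "p 1 = 1 \<and> p 2 = 2"
      using *[of 1 1] *[of 3 1] *[of 1 3] *[of 3 3] I
      by (auto simp: row_def endo_s[OF y] y_def par par[unfolded One_nat_def])
    then show "p = \<one>\<^bsub>sym_group 3\<^esub>"
      using permutes_123_eq_id[OF p] by (simp add: sym_group_def)
  qed (use n sym_group_is_group in simp_all)
qed

subsection \<open>The case \<open>n \<ge> 5\<close>\<close>

definition twist_image :: "nat \<Rightarrow> nat word set"
  where "twist_image i = (if i = 3 then s 3 \<otimes> s 1 else s i)"

definition twist :: "nat word set \<Rightarrow> nat word set"
  where "twist = endo twist_image"

text \<open>The only neighbour 2 of 1 is also a neighbour of 3, so every generator that commutes
  with \<open>s 3\<close> commutes with \<open>s 1\<close>, and multiplying \<open>s 3\<close> by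
  \<open>s 1\<close> preserves the relations.\<close>

lemma twist:
  assumes n: "n \<ge> 5"
  shows twist_s: "i \<in> I \<Longrightarrow> twist (s i) = twist_image i"
    and twist_Aut: "twist \<in> carrier Aut" and twist_sq: "twist \<otimes>\<^bsub>Aut\<^esub> twist = \<one>\<^bsub>Aut\<^esub>"
proof -
  have I: "1 \<in> I" "3 \<in> I" using n by (auto simp: I_def)
  have s31: "s 3 \<otimes> s 1 = s 1 \<otimes> s 3"
    using I by (intro s_comm) auto
  \<comment> \<open>\<open>adj 1 0\<close> holds for the bare numbers, so 0 has to be excluded
    separately.\<close>
  have I0: "0 \<notin> I" by (simp add: I_def)
  have images: "gen_images twist_image"
  proof -
    have "twist_image i \<in> carrier G \<and> twist_image i \<otimes> twist_image i = \<one>" if "i \<in> I" for i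
      using that I s31 s_comm_left[of 3 1 "s 3"] by (simp add: twist_image_def m_assoc)
    moreover have "twist_image i \<otimes> twist_image j = twist_image j \<otimes> twist_image i"
      if "i \<in> I" "j \<in> I" "i \<noteq> j" "\<not> adj i j" for i j
    proof -
      have *: "s 3 \<otimes> s 1 \<otimes> s k = s k \<otimes> (s 3 \<otimes> s 1)" if "k \<in> I" "\<not> adj 3 k" for k
      proof -
        have "\<not> adj 1 k" using that I0 by (cases "k = 0") auto
        then show ?thesis
          using that I s_comm[of 1 k] s_comm_left[of 3 k "s 1"] by (simp add: m_assoc)
      qed
      show ?thesis
        using that *[of i] *[of j] by (auto simp: twist_image_def s_comm[of i j])
    qed
    ultimately show ?thesis unfolding gen_images_def by blast
  qed
  show s: "twist (s i) = twist_image i" if "i \<in> I" for i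
    using that by (simp add: twist_def endo_s[OF images])
  have "twist (twist_image i) = s i" if "i \<in> I" for i
  proof -
    have "twist (s 3 \<otimes> s 1) = twist (s 3) \<otimes> twist (s 1)"
      unfolding twist_def using I by (intro hom_mult[OF endo_hom[OF images]]) auto
    also have "\<dots> = s 3"
      using I by (simp add: s twist_image_def m_assoc)
    finally show ?thesis
      using s[OF that] by (simp add: twist_image_def)
  qed
  then show "twist \<in> carrier Aut" "twist \<otimes>\<^bsub>Aut\<^esub> twist = \<one>\<^bsub>Aut\<^esub>"
    using endo_involution[OF images] by (simp_all add: twist_def)
qed

text \<open>A column operation over Z/2: composition with \<open>twist\<close> on the right adds
  column 1 to column 3.\<close>

lemma row_twist:
  assumes n: "n \<ge> 5" and f: "f \<in> carrier Aut"
  shows "i \<in> row (f \<otimes>\<^bsub>Aut\<^esub> twist) a \<longleftrightarrow> (i \<in> row f a) \<noteq> (i = 3 \<and> 1 \<in> row f a)"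
proof -
  have I: "1 \<in> I" "3 \<in> I" using n by (auto simp: I_def)
  have "par (f (twist_image i)) a \<longleftrightarrow> (i \<in> row f a) \<noteq> (i = 3 \<and> 1 \<in> row f a)" if "i \<in> I"
  proof (cases "i = 3")
    case True
    then show ?thesis
      using I Aut_mult[OF f, of "s 3" "s 1"] Aut_closed[OF f]
      by (simp add: twist_image_def row_def)
  next
    case False
    then show ?thesis using that by (simp add: twist_image_def row_def)
  qed
  moreover have "i \<in> I" if "i \<in> row f a \<or> i = 3" using that I row_subset by auto
  ultimately show ?thesis
    by (auto simp: row_mult[OF f twist_Aut[OF n]] twist_s[OF n])
qed

lemma row_flip_twist_flip:
  assumes n: "n \<ge> 5" and f: "f \<in> carrier Aut"
  shows "i \<in> row (f \<otimes>\<^bsub>Aut\<^esub> (flip \<otimes>\<^bsub>Aut\<^esub> twist \<otimes>\<^bsub>Aut\<^esub> flip)) a \<longleftrightarrow>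
    (i \<in> row f a) \<noteq> (i = n - 3 \<and> n - 1 \<in> row f a)"
proof -
  interpret A: group Aut by (rule AutoGroup)
  have "f \<otimes>\<^bsub>Aut\<^esub> (flip \<otimes>\<^bsub>Aut\<^esub> twist \<otimes>\<^bsub>Aut\<^esub> flip) = f \<otimes>\<^bsub>Aut\<^esub> flip \<otimes>\<^bsub>Aut\<^esub> twist \<otimes>\<^bsub>Aut\<^esub> flip"
    using f flip_Aut twist_Aut[OF n] by (simp add: A.m_assoc)
  then have eq: "i \<in> row (f \<otimes>\<^bsub>Aut\<^esub> (flip \<otimes>\<^bsub>Aut\<^esub> twist \<otimes>\<^bsub>Aut\<^esub> flip)) a \<longleftrightarrow>
      i \<in> I \<and> (n - i \<in> I \<and> n - (n - i) \<in> row f a) \<noteq> (n - i = 3 \<and> 1 \<in> I \<and> n - 1 \<in> row f a)"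
    using f flip_Aut twist_Aut[OF n] by (simp add: row_flip row_twist[OF n])
  have I: "1 \<in> I" "n - 3 \<in> I" using n by (auto simp: I_def)
  show ?thesis
  proof (cases "i \<in> I")
    case True
    then have "n - i = 3 \<longleftrightarrow> i = n - 3" using n by (auto simp: I_def)
    then show ?thesis using True I eq by simp
  next
    case False
    then show ?thesis using I row_subset eq by blast
  qed
qed

text \<open>At most one index is adjacent to two given ones. If row \<open>a\<close> had two
  elements, the rows before and after it would both consist of that single index, although rows are
  distinct.\<close>

lemma row_interior:
  assumes f: "f \<in> carrier Aut" and a: "a - 1 \<in> I" "a \<in> I" "Suc a \<in> I" and k: "k \<in> row f a"
  shows "row f a = {k}"
proof (rule ccontr)
  assume "row f a \<noteq> {k}"
  then obtain l where l: "l \<in> row f a" "l \<noteq> k" using k by blast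
  have "a \<ge> 1" using a by (auto simp: I_def)
  then have adj: "adj (a - 1) a" "adj (Suc a) a" by auto
  have x: "adj x k \<and> adj x l" if "x \<in> row f (a - 1) \<or> x \<in> row f (Suc a)" for x
    using that row_adj[OF f adj(1) _ k] row_adj[OF f adj(1) _ l(1)]
      row_adj[OF f adj(2) _ k] row_adj[OF f adj(2) _ l(1)] by blast
  have eq: "x = y" if "adj x k" "adj x l" "adj y k" "adj y l" for x y
    using that l(2) by auto
  have ne: "row f (a - 1) \<noteq> {}" "row f (Suc a) \<noteq> {}"
    using a by (simp_all add: row_nonempty[OF f])
  then obtain x where x0: "x \<in> row f (a - 1)" by blast
  have all: "y = x" if "y \<in> row f (a - 1) \<or> y \<in> row f (Suc a)" for y
    using x[OF that] x[of x] x0 eq[of y x] by blast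
  then have "row f (a - 1) = {x}" "row f (Suc a) = {x}"
    using x0 ne by blast+
  then show False
    using row_inj[OF f a(1,3)] by simp
qed

text \<open>Neighbouring rows hold adjacent indices and rows two apart differ, so the interior rows
  climb without turning back: row \<open>2 + a\<close> is \<open>{k + a}\<close>. The end rows must
  extend this run at both ends, and it fits into \<open>I\<close> only if
  \<open>k = 2\<close>.\<close>

lemma rows_of_increasing:
  assumes n: "n \<ge> 5" and f: "f \<in> carrier Aut" and k: "k \<in> row f 2" "Suc k \<in> row f 3"
  shows "\<And>a. 2 \<le> a \<Longrightarrow> a < n - 1 \<Longrightarrow> row f a = {a}"
    and "1 \<in> row f 1" "row f 1 \<subseteq> {1, 3}" "n - 1 \<in> row f (n - 1)" "row f (n - 1) \<subseteq> {n - 1, n - 3}"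
proof -
  have single: "row f a = {x}" if "2 \<le> a" "a < n - 1" "x \<in> row f a" for a x
    using that by (intro row_interior[OF f]) (auto simp: I_def)
  have inj: "a = b" if "a \<in> I" "b \<in> I" "row f a = row f b" for a b
    by (rule row_inj[OF f that])
  have int: "k + a \<in> row f (2 + a)" if "2 + a < n - 1" for a
    using that
  proof (induction a rule: less_induct)
    case (less a)
    consider "a = 0" | "a = 1" | b where "a = Suc (Suc b)"
      by (metis One_nat_def not0_implies_Suc)
    then show ?case
    proof cases
      case (3 b)
      have IH: "k + b \<in> row f (2 + b)" "k + Suc b \<in> row f (2 + Suc b)"
        using less.IH[of b] less.IH[of "Suc b"] less.prems 3 by simp_all
      obtain x where x: "x \<in> row f (2 + a)"
        using row_nonempty[OF f, of "2 + a"] less.prems by (auto simp: I_def)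
      have "adj x (k + Suc b)"
        using row_adj[OF f _ x IH(2)] 3 by simp
      moreover have "x \<noteq> k + b"
      proof
        assume "x = k + b"
        then have "row f (2 + a) = row f (2 + b)"
          using single[OF _ _ x] single[OF _ _ IH(1)] less.prems 3 by simp
        then show False
          using inj[of "2 + a" "2 + b"] less.prems 3 by (simp add: I_def)
      qed
      ultimately have "x = k + a" using 3 by auto
      then show ?thesis using x by simp
    qed (use k in \<open>simp_all add: numeral_3_eq_3 numeral_2_eq_2\<close>)
  qed
  define m where "m = n - 1"
  \<comment> \<open>\<open>2 + c = m - 1\<close> is the last interior index.\<close>
  define c where "c = m - 3"
  have m: "m \<ge> 4" "m = c + 3" "c \<ge> 1" "I = {1..m}" using n by (simp_all add: m_def c_def I_def)
  have r2: "row f 2 = {k}" and r3: "row f 3 = {Suc k}"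
    using single k m unfolding m_def by auto
  have first: "x = Suc k \<or> Suc x = k" if "x \<in> row f 1" for x
    using row_adj[OF f _ that k(1)] by auto
  have "\<exists>x\<in>row f 1. Suc x = k"
  proof (rule ccontr)
    assume "\<not> ?thesis"
    then have "row f 1 = {Suc k}"
      using first row_nonempty[OF f, of 1] m by auto
    then show False using inj[of 1 3] r3 m by auto
  qed
  then obtain x where x: "x \<in> row f 1" "Suc x = k" by blast
  have "x \<ge> 1" using row_subset x(1) m by fastforce
  have im: "k + c \<in> row f (2 + c)" "k + (c - 1) \<in> row f (2 + (c - 1))"
    using int[of c] int[of "c - 1"] m unfolding m_def[symmetric] by simp_all
  have last: "x = Suc (k + c) \<or> x = k + (c - 1)" if "x \<in> row f m" for x
    using row_adj[OF f _ that im(1)] m by auto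
  have rm: "row f (2 + (c - 1)) = {k + (c - 1)}"
    using single[OF _ _ im(2)] m unfolding m_def[symmetric] by simp
  have "Suc (k + c) \<in> row f m"
  proof (rule ccontr)
    assume "Suc (k + c) \<notin> row f m"
    then have "x = k + (c - 1)" if "x \<in> row f m" for x using last that by metis
    then have "row f m = {k + (c - 1)}"
      using row_nonempty[OF f, of m] m by auto
    then show False using inj[of m "2 + (c - 1)"] rm m by auto
  qed
  note end_row = this
  then have "Suc (k + c) \<le> m" using row_subset m by fastforce
  \<comment> \<open>The rows occupy the values from \<open>k - 1\<close> to
    \<open>k + c + 1\<close>, which are \<open>c + 3 = m\<close> values inside
    \<open>{1..m}\<close>.\<close>
  then have k2: "k = 2"
    using x m \<open>x \<ge> 1\<close> by auto
  then have "Suc (k + c) = m" using m by simp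
  with end_row have "m \<in> row f m" by simp
  then show "n - 1 \<in> row f (n - 1)" by (simp add: m_def)
  show "1 \<in> row f 1" using x k2 by auto
  show "row f 1 \<subseteq> {1, 3}" using first k2 by auto
  show "row f (n - 1) \<subseteq> {n - 1, n - 3}"
  proof
    fix x assume "x \<in> row f (n - 1)"
    moreover have "Suc (k + c) = n - 1" "k + (c - 1) = n - 3"
      using k2 n by (simp_all add: c_def m_def)
    ultimately show "x \<in> {n - 1, n - 3}"
      using last[of x] by (simp add: m_def)
  qed
  fix a assume a: "2 \<le> a" "a < n - 1"
  then have "a \<in> row f a" using int[of "a - 2"] by (simp only: k2 le_add_diff_inverse)
  then show "row f a = {a}" using single a by blast
qed

lemma rows_normalize_increasing:
  assumes n: "n \<ge> 5" and f: "f \<in> carrier Aut" and k: "k \<in> row f 2" "Suc k \<in> row f 3"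
  obtains h h' where "h = \<one>\<^bsub>Aut\<^esub> \<or> h = twist"
    "h' = \<one>\<^bsub>Aut\<^esub> \<or> h' = flip \<otimes>\<^bsub>Aut\<^esub> twist \<otimes>\<^bsub>Aut\<^esub> flip"
    "\<forall>a\<in>I. row (f \<otimes>\<^bsub>Aut\<^esub> h \<otimes>\<^bsub>Aut\<^esub> h') a = {a}"
proof -
  interpret A: group Aut by (rule AutoGroup)
  let ?B = "flip \<otimes>\<^bsub>Aut\<^esub> twist \<otimes>\<^bsub>Aut\<^esub> flip"
  note rows = rows_of_increasing[OF n f k]
  define h where "h = (if 3 \<in> row f 1 then twist else \<one>\<^bsub>Aut\<^esub>)"
  define g where "g = f \<otimes>\<^bsub>Aut\<^esub> h"
  define h' where "h' = (if n - 3 \<in> row g (n - 1) then ?B else \<one>\<^bsub>Aut\<^esub>)"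
  have g: "g \<in> carrier Aut"
    using f twist_Aut[OF n] by (simp add: g_def h_def)
  have row_g: "i \<in> row g a \<longleftrightarrow> (i \<in> row f a) \<noteq> (i = 3 \<and> 3 \<in> row f 1 \<and> 1 \<in> row f a)" for i a
    using f row_twist[OF n f] by (simp add: g_def h_def)
  have row_gh: "i \<in> row (g \<otimes>\<^bsub>Aut\<^esub> h') a \<longleftrightarrow>
      (i \<in> row g a) \<noteq> (i = n - 3 \<and> n - 3 \<in> row g (n - 1) \<and> n - 1 \<in> row g a)" for i a
    using g row_flip_twist_flip[OF n g] by (simp add: h'_def)
  have "row (g \<otimes>\<^bsub>Aut\<^esub> h') a = {a}" if a: "a \<in> I" for a
  proof -
    consider "a = 1" | "2 \<le> a" "a < n - 1" | "a = n - 1"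
      using a by (force simp: I_def)
    then show ?thesis
    proof cases
      case 1
      have one: "i \<in> row g 1 \<longleftrightarrow> i = 1" for i
        using rows(2,3) row_g[of i 1] by auto
      have "i \<in> row (g \<otimes>\<^bsub>Aut\<^esub> h') a \<longleftrightarrow> i = a" for i
        using row_gh[of i 1] one[of i] one[of "n - 1"] 1 n by auto
      then show ?thesis by blast
    next
      case 2
      have mid: "i \<in> row g a \<longleftrightarrow> i = a" for i
        using rows(1)[OF 2] row_g[of i a] 2 by auto
      have "i \<in> row (g \<otimes>\<^bsub>Aut\<^esub> h') a \<longleftrightarrow> i = a" for i
        using row_gh[of i a] mid[of i] mid[of "n - 1"] 2 by auto
      then show ?thesis by blast
    next
      case 3
      \<comment> \<open>As \<open>n - 3 \<noteq> 1\<close> for \<open>n \<ge> 5\<close>, the last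
        row has no entry in column 1, and \<open>twist\<close> leaves it alone.\<close>
      have "1 \<notin> row f (n - 1)"
        using rows(5) n by auto
      then have "i \<in> row g (n - 1) \<longleftrightarrow> i \<in> row f (n - 1)" for i
        using row_g[of i "n - 1"] by simp
      then have "i \<in> row (g \<otimes>\<^bsub>Aut\<^esub> h') a \<longleftrightarrow> i = n - 1" for i
        using rows(4,5) row_gh[of i "n - 1"] 3 n by auto
      then show ?thesis
        using 3 by blast
    qed
  qed
  then show thesis
    using that[of h h'] by (simp add: h_def h'_def g_def)
qed

text \<open>Rows 2 and 3 contain adjacent indices; if these decrease, the flip makes them
  increase.\<close>

lemma rows_normalize:
  assumes n: "n \<ge> 5" and f: "f \<in> carrier Aut"
  obtains d h h' where "d = \<one>\<^bsub>Aut\<^esub> \<or> d = flip" "h = \<one>\<^bsub>Aut\<^esub> \<or> h = twist"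
    "h' = \<one>\<^bsub>Aut\<^esub> \<or> h' = flip \<otimes>\<^bsub>Aut\<^esub> twist \<otimes>\<^bsub>Aut\<^esub> flip"
    "\<forall>a\<in>I. row (f \<otimes>\<^bsub>Aut\<^esub> d \<otimes>\<^bsub>Aut\<^esub> h \<otimes>\<^bsub>Aut\<^esub> h') a = {a}"
proof -
  interpret A: group Aut by (rule AutoGroup)
  have "row f 2 \<noteq> {}" "row f 3 \<noteq> {}"
    using n by (auto intro!: row_nonempty[OF f] simp: I_def)
  then obtain k l where kl: "k \<in> row f 2" "l \<in> row f 3" by blast
  have "adj k l" using row_adj[OF f _ kl] by simp
  then show thesis
  proof
    assume "l = Suc k"
    then obtain h h' where "h = \<one>\<^bsub>Aut\<^esub> \<or> h = twist"
      "h' = \<one>\<^bsub>Aut\<^esub> \<or> h' = flip \<otimes>\<^bsub>Aut\<^esub> twist \<otimes>\<^bsub>Aut\<^esub> flip"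
      "\<forall>a\<in>I. row (f \<otimes>\<^bsub>Aut\<^esub> h \<otimes>\<^bsub>Aut\<^esub> h') a = {a}"
      using rows_normalize_increasing[OF n f, of k] kl by blast
    then show thesis
      using that[of "\<one>\<^bsub>Aut\<^esub>" h h'] f by simp
  next
    assume k: "k = Suc l"
    have ff: "f \<otimes>\<^bsub>Aut\<^esub> flip \<in> carrier Aut" using f flip_Aut by simp
    have I: "k \<in> I" "l \<in> I" using kl row_subset by auto
    have "n - l = Suc (n - k)" using k I by (auto simp: I_def)
    then have "n - k \<in> row (f \<otimes>\<^bsub>Aut\<^esub> flip) 2" "Suc (n - k) \<in> row (f \<otimes>\<^bsub>Aut\<^esub> flip) 3"
      using kl I flip_I[of l] flip_flip[of l] by (auto simp: row_flip[OF f])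
    then obtain h h' where "h = \<one>\<^bsub>Aut\<^esub> \<or> h = twist"
      "h' = \<one>\<^bsub>Aut\<^esub> \<or> h' = flip \<otimes>\<^bsub>Aut\<^esub> twist \<otimes>\<^bsub>Aut\<^esub> flip"
      "\<forall>a\<in>I. row (f \<otimes>\<^bsub>Aut\<^esub> flip \<otimes>\<^bsub>Aut\<^esub> h \<otimes>\<^bsub>Aut\<^esub> h') a = {a}"
      using rows_normalize_increasing[OF n ff, of "n - k"] by blast
    then show thesis
      using that[of flip h h'] by simp
  qed
qed

text \<open>One map multiplies \<open>s 3\<close> by \<open>s 1\<close>, the other
  \<open>s (n - 3)\<close> by \<open>s (n - 1)\<close>, and for \<open>n \<ge> 5\<close> each fixes
  the factor of the other. They alter the same generator only for \<open>n = 6\<close>, where the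
  factors \<open>s 1\<close> and \<open>s 5\<close> commute.\<close>

lemma twist_commute:
  assumes n: "n \<ge> 5"
  shows "twist \<otimes>\<^bsub>Aut\<^esub> (flip \<otimes>\<^bsub>Aut\<^esub> twist \<otimes>\<^bsub>Aut\<^esub> flip) =
    (flip \<otimes>\<^bsub>Aut\<^esub> twist \<otimes>\<^bsub>Aut\<^esub> flip) \<otimes>\<^bsub>Aut\<^esub> twist"
proof -
  interpret A: group Aut by (rule AutoGroup)
  define B where "B = flip \<otimes>\<^bsub>Aut\<^esub> twist \<otimes>\<^bsub>Aut\<^esub> flip"
  have T: "twist \<in> carrier Aut" and B: "B \<in> carrier Aut"
    using twist_Aut[OF n] flip_Aut by (simp_all add: B_def)
  have I: "1 \<in> I" "3 \<in> I" "n - 1 \<in> I" "n - 3 \<in> I" using n by (auto simp: I_def)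
  have Bs: "B (s i) = (if i = n - 3 then s (n - 3) \<otimes> s (n - 1) else s i)" if "i \<in> I" for i
  proof -
    have "B (s i) = flip (twist_image (n - i))"
      using that mult_Aut[OF A.m_closed[OF flip_Aut T] flip_Aut, of "s i"]
        mult_Aut[OF flip_Aut T, of "s (n - i)"] by (simp add: B_def twist_s[OF n])
    also have "\<dots> = (if i = n - 3 then s (n - 3) \<otimes> s (n - 1) else s i)"
    proof -
      have "n - i = 3 \<longleftrightarrow> i = n - 3" using that n by (auto simp: I_def)
      then show ?thesis
        using that I Aut_mult[OF flip_Aut, of "s 3" "s 1"] by (auto simp: twist_image_def)
    qed
    finally show ?thesis .
  qed
  have ne: "n - 1 \<noteq> 3" "n - 3 \<noteq> 1" "n - 1 \<noteq> n - 3" "1 \<noteq> n - 3" "n - 1 \<noteq> 1" "\<not> adj 1 (n - 1)"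
    using n by auto
  have Ts: "twist (s i) = (if i = 3 then s 3 \<otimes> s 1 else s i)" if "i \<in> I" for i
    using twist_s[OF n that] by (simp add: twist_image_def)
  have "twist \<otimes>\<^bsub>Aut\<^esub> B = B \<otimes>\<^bsub>Aut\<^esub> twist"
  proof (rule Aut_eqI)
    fix i assume i: "i \<in> I"
    have a: "twist (s (n - 3) \<otimes> s (n - 1)) = twist (s (n - 3)) \<otimes> s (n - 1)"
      using Aut_mult[OF T, of "s (n - 3)" "s (n - 1)"] I Ts ne by simp
    have b: "B (s 3 \<otimes> s 1) = B (s 3) \<otimes> s 1"
      using Aut_mult[OF B, of "s 3" "s 1"] I Bs ne by simp
    have c: "s 1 \<otimes> s (n - 1) = s (n - 1) \<otimes> s 1"
      using I ne by (intro s_comm) auto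
    have "twist (B (s i)) = B (twist (s i))"
    proof (cases "i = 3")
      case 3: True
      show ?thesis
      proof (cases "3 = n - 3")
        case True
        have "twist (B (s 3)) = s 3 \<otimes> s 1 \<otimes> s (n - 1)"
          using Bs[OF I(2)] a Ts[OF I(2)] True by metis
        moreover have "B (twist (s 3)) = s 3 \<otimes> s (n - 1) \<otimes> s 1"
          using Bs[OF I(2)] b Ts[OF I(2)] True by metis
        ultimately show ?thesis
          using 3 I c by (simp add: m_assoc)
      next
        case False
        have "B (s 3) = s 3" using Bs[OF I(2)] False by metis
        then show ?thesis using b Ts[OF I(2)] 3 by metis
      qed
    next
      case n3: False
      then have t: "twist (s i) = s i" using Ts[OF i] by simp
      show ?thesis
      proof (cases "i = n - 3")
        case True
        then show ?thesis using t Bs[OF i] a by metis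
      next
        case False
        then show ?thesis using t Bs[OF i] by metis
      qed
    qed
    then show "(twist \<otimes>\<^bsub>Aut\<^esub> B) (s i) = (B \<otimes>\<^bsub>Aut\<^esub> twist) (s i)"
      using i by (simp add: mult_Aut[OF T B] mult_Aut[OF B T])
  qed (use T B in simp_all)
  then show ?thesis by (simp only: B_def)
qed

text \<open>The square of \<open>twist \<otimes> flip\<close> is the product of the twist and its
  conjugate by the flip. These are commuting involutions, so the fourth power is trivial and
  \<open>hom_dihedral_group\<close> applies.\<close>

lemma Aut_split_ge_5:
  assumes n: "n \<ge> 5"
  shows "Aut_iso_semidirect G (dihedral_group 4)"
proof -
  interpret A: group Aut by (rule AutoGroup)
  let ?D = "dihedral_group 4"
  interpret D: group ?D by (rule group_dihedral_group)
  note T = twist_Aut[OF n] and TT = twist_sq[OF n]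
  define p where "p = twist \<otimes>\<^bsub>Aut\<^esub> flip"
  define B where "B = flip \<otimes>\<^bsub>Aut\<^esub> twist \<otimes>\<^bsub>Aut\<^esub> flip"
  have p: "p \<in> carrier Aut" and B: "B \<in> carrier Aut" using T flip_Aut by (simp_all add: p_def B_def)
  have inv: "inv\<^bsub>Aut\<^esub> twist = twist" "inv\<^bsub>Aut\<^esub> flip = flip"
    using T TT flip_Aut flip_sq by (simp_all add: A.inv_equality)
  have cancel: "flip \<otimes>\<^bsub>Aut\<^esub> (flip \<otimes>\<^bsub>Aut\<^esub> x) = x" "twist \<otimes>\<^bsub>Aut\<^esub> (twist \<otimes>\<^bsub>Aut\<^esub> x) = x"
    if "x \<in> carrier Aut" for x
    using that T TT flip_Aut flip_sq by (simp_all flip: A.m_assoc)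
  have BB: "B \<otimes>\<^bsub>Aut\<^esub> B = \<one>\<^bsub>Aut\<^esub>"
    using T TT flip_Aut flip_sq cancel by (simp add: B_def A.m_assoc)
  have p2: "p [^]\<^bsub>Aut\<^esub> (2::nat) = twist \<otimes>\<^bsub>Aut\<^esub> B"
    using p T flip_Aut by (simp add: numeral_2_eq_2 p_def B_def A.m_assoc)
  have "p [^]\<^bsub>Aut\<^esub> (4::nat) = p [^]\<^bsub>Aut\<^esub> (2::nat) \<otimes>\<^bsub>Aut\<^esub> p [^]\<^bsub>Aut\<^esub> (2::nat)"
    using p by (simp add: A.nat_pow_mult)
  also have "\<dots> = twist \<otimes>\<^bsub>Aut\<^esub> (B \<otimes>\<^bsub>Aut\<^esub> twist) \<otimes>\<^bsub>Aut\<^esub> B"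
    using T B by (simp add: p2 A.m_assoc)
  also have "\<dots> = \<one>\<^bsub>Aut\<^esub>"
    using T TT B BB cancel twist_commute[OF n, folded B_def, symmetric] by (simp add: A.m_assoc)
  finally have p4: "p [^]\<^bsub>Aut\<^esub> (4::nat) = \<one>\<^bsub>Aut\<^esub>" .
  define \<rho> where "\<rho> = (\<lambda>(r::int, e::int). p [^]\<^bsub>Aut\<^esub> r \<otimes>\<^bsub>Aut\<^esub> (if e = 0 then \<one>\<^bsub>Aut\<^esub> else flip))"
  have \<rho>: "\<rho> \<in> hom ?D Aut"
    using A.hom_dihedral_group[OF T flip_Aut TT flip_sq, of 4] p4 by (simp add: \<rho>_def p_def)
  interpret \<rho>: group_hom ?D Aut \<rho> by (unfold_locales) (rule \<rho>)
  have carr: "carrier ?D = {0..<4} \<times> {0..<2}"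
    by (simp add: dihedral_group_def semidirect_product_def carrier_integer_mod_group)
  define H where "H = \<rho> ` carrier ?D"
  have H: "subgroup H Aut"
    unfolding H_def by (rule \<rho>.img_is_subgroup)
  have "\<rho> (0, 1) = flip" "\<rho> (1, 1) = twist"
    using p T flip_Aut flip_sq by (simp_all add: \<rho>_def A.m_assoc) (simp add: p_def A.m_assoc flip_sq T flip_Aut)
  moreover have "(0, 1) \<in> carrier ?D" "(1, 1) \<in> carrier ?D" by (simp_all add: carr)
  ultimately have gens: "flip \<in> H" "twist \<in> H"
    unfolding H_def by (metis imageI)+
  show ?thesis
  proof (rule split_of_rows[OF _ _ \<rho>])
    fix f assume f: "f \<in> carrier Aut"
    obtain d h h' where dh: "d = \<one>\<^bsub>Aut\<^esub> \<or> d = flip" "h = \<one>\<^bsub>Aut\<^esub> \<or> h = twist" "h' = \<one>\<^bsub>Aut\<^esub> \<or> h' = B"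
      and rows: "\<forall>a\<in>I. row (f \<otimes>\<^bsub>Aut\<^esub> d \<otimes>\<^bsub>Aut\<^esub> h \<otimes>\<^bsub>Aut\<^esub> h') a = {a}"
      by (rule rows_normalize[OF n f, folded B_def])
    have in_H: "d \<in> H" "h \<in> H" "h' \<in> H"
      using dh gens subgroup.one_closed[OF H] subgroup.m_closed[OF H] by (auto simp: B_def)
    then have "d \<otimes>\<^bsub>Aut\<^esub> h \<otimes>\<^bsub>Aut\<^esub> h' \<in> H"
      using subgroup.m_closed[OF H] by blast
    then obtain k where k: "k \<in> carrier ?D" "d \<otimes>\<^bsub>Aut\<^esub> h \<otimes>\<^bsub>Aut\<^esub> h' = \<rho> k"
      unfolding H_def by (rule imageE)
    have "f \<otimes>\<^bsub>Aut\<^esub> d \<otimes>\<^bsub>Aut\<^esub> h \<otimes>\<^bsub>Aut\<^esub> h' = f \<otimes>\<^bsub>Aut\<^esub> (d \<otimes>\<^bsub>Aut\<^esub> h \<otimes>\<^bsub>Aut\<^esub> h')"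
      using f in_H subgroup.mem_carrier[OF H] by (simp add: A.m_assoc)
    then have "\<forall>a\<in>I. row (f \<otimes>\<^bsub>Aut\<^esub> \<rho> k) a = {a}"
      using rows by (simp only: k(2))
    then show "\<exists>k\<in>carrier ?D. \<forall>a\<in>I. row (f \<otimes>\<^bsub>Aut\<^esub> \<rho> k) a = {a}"
      using k(1) by blast
  next
    fix k assume k: "k \<in> carrier ?D" and rows: "\<forall>a\<in>I. row (\<rho> k) a = {a}"
    obtain r e where re: "k = (r, e)" "r \<in> {0..<4}" "e \<in> {0..<2}"
      using k carr by auto
    have I: "1 \<in> I" "3 \<in> I" "n - 1 \<in> I" "n - 3 \<in> I" using n by (auto simp: I_def)
    have one_row: "\<And>a. row \<one>\<^bsub>Aut\<^esub> a = I \<inter> {a}"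
      by (auto simp: row_def one_Aut)
    have row_T: "i \<in> row twist a \<longleftrightarrow> i \<in> I \<and> ((i = a) \<noteq> (i = 3 \<and> a = 1))" for i a
      using row_twist[OF n A.one_closed, of i a] T I by (auto simp: one_row)
    have row_B: "i \<in> row B a \<longleftrightarrow> i \<in> I \<and> ((i = a) \<noteq> (i = n - 3 \<and> a = n - 1))" for i a
      using row_flip_twist_flip[OF n A.one_closed, of i a] B I n by (auto simp: one_row B_def)
    have row_F: "i \<in> row flip a \<longleftrightarrow> i \<in> I \<and> n - i = a" for i a
      using row_flip[OF A.one_closed, of i a] flip_Aut by (auto simp: one_row)
    have ne: "n - 1 \<noteq> 1" "n - 1 \<noteq> 3" "n - 1 \<noteq> n - 3" "n - (n - 1) = 1" "n - 3 \<noteq> 1" using n by auto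
    \<comment> \<open>Nontrivial products with an even number of flips leave an extra entry in row 1
      or row \<open>n - 1\<close>; those with an odd number put column 1 into row
      \<open>n - 1\<close>. Either way the matrix is not trivial.\<close>
    have not_even: False if "\<forall>a\<in>I. row f a = {a}" "f = twist \<or> f = B \<or> f = twist \<otimes>\<^bsub>Aut\<^esub> B" for f
      using that(2)
    proof (elim disjE)
      assume "f = twist"
      then have "3 \<in> row f 1" using row_T[of 3 1] I by simp
      then show False using that(1) I by auto
    next
      assume "f = B"
      then have "n - 3 \<in> row f (n - 1)" using row_B[of "n - 3" "n - 1"] I ne by auto
      then show False using that(1) I ne by auto
    next
      assume "f = twist \<otimes>\<^bsub>Aut\<^esub> B"
      then have "3 \<in> row f 1"
        using row_flip_twist_flip[OF n T, of 3 1, folded B_def] row_T[of 3 1] row_T[of "n - 1" 1] I ne by auto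
      then show False using that(1) I by auto
    qed
    have not_odd: False if "\<forall>a\<in>I. row f a = {a}" "f = flip \<or> f = twist \<otimes>\<^bsub>Aut\<^esub> flip \<or>
        f = flip \<otimes>\<^bsub>Aut\<^esub> twist \<or> f = twist \<otimes>\<^bsub>Aut\<^esub> flip \<otimes>\<^bsub>Aut\<^esub> twist" for f
    proof -
      have "1 \<in> row f (n - 1)"
        using that(2) T flip_Aut I ne row_F[of _ "n - 1"] row_T[of _ "n - 1"]
          row_flip[OF T, of 1 "n - 1"] row_twist[OF n flip_Aut, of 1 "n - 1"]
          row_twist[OF n A.m_closed[OF T flip_Aut], of 1 "n - 1"] by auto
      then show False using that(1) I ne by auto
    qed
    have "p [^]\<^bsub>Aut\<^esub> (3::int) \<otimes>\<^bsub>Aut\<^esub> p = p [^]\<^bsub>Aut\<^esub> (4::nat)"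
      using p A.int_pow_mult[of p 3 1] int_pow_int[of Aut p 4] by simp
    then have p3: "p [^]\<^bsub>Aut\<^esub> (3::int) = flip \<otimes>\<^bsub>Aut\<^esub> twist"
      using p p4 T flip_Aut A.inv_equality[of "p [^]\<^bsub>Aut\<^esub> (3::int)" p]
      by (simp add: p_def A.inv_mult_group inv)
    have p2': "p [^]\<^bsub>Aut\<^esub> (2::int) = twist \<otimes>\<^bsub>Aut\<^esub> B"
      using p2 int_pow_int[of Aut p 2] by simp
    have "twist \<otimes>\<^bsub>Aut\<^esub> B \<otimes>\<^bsub>Aut\<^esub> flip = twist \<otimes>\<^bsub>Aut\<^esub> flip \<otimes>\<^bsub>Aut\<^esub> twist"
      using T flip_Aut flip_sq cancel by (simp add: B_def A.m_assoc)
    moreover have "flip \<otimes>\<^bsub>Aut\<^esub> twist \<otimes>\<^bsub>Aut\<^esub> flip = B" by (simp add: B_def)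
    moreover have "p \<otimes>\<^bsub>Aut\<^esub> flip = twist"
      using T flip_Aut flip_sq by (simp add: p_def A.m_assoc)
    moreover have "r = 0 \<or> r = 1 \<or> r = 2 \<or> r = 3" "e = 0 \<or> e = 1" using re by auto
    ultimately have "(r = 0 \<and> e = 0) \<or> \<rho> k \<in> {twist, B, twist \<otimes>\<^bsub>Aut\<^esub> B} \<or>
        \<rho> k \<in> {flip, p, flip \<otimes>\<^bsub>Aut\<^esub> twist, twist \<otimes>\<^bsub>Aut\<^esub> flip \<otimes>\<^bsub>Aut\<^esub> twist}"
      using p T B flip_Aut by (auto simp: \<rho>_def re(1) p3 p2')
    moreover have "\<rho> k \<notin> {twist, B, twist \<otimes>\<^bsub>Aut\<^esub> B}"
      using not_even[OF rows] by blast
    moreover have "\<rho> k \<notin> {flip, p, flip \<otimes>\<^bsub>Aut\<^esub> twist, twist \<otimes>\<^bsub>Aut\<^esub> flip \<otimes>\<^bsub>Aut\<^esub> twist}"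
      using not_odd[OF rows] unfolding p_def by blast
    ultimately have "k = (0, 0)"
      using re by auto
    then show "k = \<one>\<^bsub>?D\<^esub>"
      by (simp add: dihedral_group_def semidirect_product_def)
  qed (use n group_dihedral_group in simp_all)
qed

end

theorem theorem6p1:
  fixes n :: nat
  assumes "n \<ge> 3"
  shows "(n = 3 \<longrightarrow> Aut_iso_semidirect (twin_group n) (integer_mod_group 2)) \<and>
         (n = 4 \<longrightarrow> Aut_iso_semidirect (twin_group n) (sym_group 3)) \<and>
         (n \<ge> 5 \<longrightarrow> Aut_iso_semidirect (twin_group n) (dihedral_group 4))"
proof -
  interpret twin "twin_group n" n
    unfolding twin_def twin_axioms_def twin_group_def by (simp add: group_presented_group)
  show ?thesis
    using Aut_split_3 Aut_split_4 Aut_split_ge_5 by blast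
qed

end
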